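(* $$f(e^{-\pi},e^{-5\pi})=2^{-5/4}\,3^{-3/8}\,e^{\pi/3}\,(\sqrt3+1)^{5/6}\,\frac{(1+\sqrt3+\sqrt2\cdot 3^{3/4})^{5/3}}{(1+\sqrt3+\sqrt2\,\sqrt[4]{3})\left(2+\sqrt3+\tfrac12(\sqrt2+\sqrt6)\,3^{3/4}\right)}\,\frac{\pi^{1/4}}{\Gamma(\tfrac34)}.$$
   Context: For $|ab|<1$, $f(a,b)=\sum_{k=-\infty}^{\infty}a^{k(k+1)/2}b^{k(k-1)/2}$ (Ramanujan's general theta function). $\Gamma$ is the Gamma function; all roots and fractional powers are of positive reals and denote the positive value. *)

theory Defs
  imports "HOL-Analysis.Analysis"
begin

text \<open>
  Ramanujan's general theta function, meaningful for \<open>norm (a * b) < 1\<close>, where the two-sided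
  series converges absolutely. The products \<open>k * (k + 1)\<close> and \<open>k * (k - 1)\<close> are even and
  nonnegative for every integer \<open>k\<close>, so the integer divisions are exact and only
  nonnegative powers occur.
\<close>

definition ramanujan_theta :: "'a::{real_normed_field, banach} \<Rightarrow> 'a \<Rightarrow> 'a" where
  "ramanujan_theta a b =
     (\<Sum>\<^sub>\<infinity>k\<in>(UNIV :: int set). a powi (k * (k + 1) div 2) * b powi (k * (k - 1) div 2))"

end

theory Submission
  imports Defs "HOL-Real_Asymp.Real_Asymp"
begin

text \<open>
  With \<open>\<phi>(q) = \<Sum>\<^sub>n q\<^bsup>n\<^sup>2\<^esup>\<close> and \<open>x = e\<^bsup>-\<pi>/3\<^esup>\<close>, the terms of \<open>\<phi>(x)\<close> whose index is not a multiple of 3 sum to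
  \<open>\<phi>(x) - \<phi>(x\<^sup>9) = 2 x f(x\<^sup>3, x\<^bsup>15\<^esup>)\<close>, and the inversion formula \<open>\<phi>(e\<^bsup>-\<pi>/3\<^esup>) = \<surd>3 \<phi>(e\<^bsup>-3\<pi>\<^esup>)\<close> reduces
  the claim to \<open>\<phi>(e\<^bsup>-3\<pi>\<^esup>)\<close>. The product formula for \<open>\<phi>\<close> gives
  \<open>\<phi>(x) \<phi>(\<omega>x) \<phi>(\<omega>\<^sup>2x) \<phi>(x\<^sup>9) = \<phi>(x\<^sup>3)\<^sup>4\<close> for a primitive cube root of unity \<open>\<omega>\<close>, hence
  \<open>\<phi>(e\<^bsup>-\<pi>\<^esup>)\<^sup>4 = (6\<surd>3 - 9) \<phi>(e\<^bsup>-3\<pi>\<^esup>)\<^sup>4\<close>. Finally \<open>\<phi>(q)\<^sup>2\<close> and \<open>\<phi>(-q)\<^sup>2\<close> have arithmetic-geometric mean 1;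
  for \<open>q = e\<^bsup>-\<pi>\<^esup>\<close> their ratio is \<open>\<surd>2\<close>, so Gauss' integral for the mean becomes a Beta integral and
  \<open>\<phi>(e\<^bsup>-\<pi>\<^esup>) = \<pi>\<^bsup>1/4\<^esup> / \<Gamma>(3/4)\<close>. The inversion formula is obtained by Polya's method: it is the limit of the
  multisection formula for central binomial coefficients.
\<close>

section \<open>The theta series\<close>

text \<open>An absolutely summable family is an integrable function for the counting measure, so
  this is Lebesgue's theorem. It justifies each exchange of limit and two-sided series below: the
  triple product, both sides of the multisection formula, and the theta series as its argument tends
  to 0.\<close>

lemma infsum_dominated_convergence:
  fixes f :: "nat \<Rightarrow> 'b \<Rightarrow> 'a::{banach, second_countable_topology}"
  assumes lim: "\<And>x. x \<in> A \<Longrightarrow> (\<lambda>n. f n x) \<longlonglongrightarrow> g x"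
    and bound: "\<And>n x. x \<in> A \<Longrightarrow> norm (f n x) \<le> h x"
    and h: "h summable_on A"
  shows "(\<lambda>n. infsum (f n) A) \<longlonglongrightarrow> infsum g A"
proof -
  have h': "integrable (count_space A) h"
    using h by (metis abs_summable_on_def abs_summable_equivalent summable_on_iff_abs_summable_on_real)
  have lim': "AE x in count_space A. (\<lambda>n. f n x) \<longlonglongrightarrow> g x"
    using lim by (simp add: AE_count_space)
  have bound': "AE x in count_space A. norm (f n x) \<le> h x" for n
    using bound by (simp add: AE_count_space)
  have "integrable (count_space A) (f n)" for n
    by (rule integrable_dominated_convergence2[OF _ _ h' lim' bound']) auto
  hence f: "infsum (f n) A = (\<integral>x. f n x \<partial>count_space A)" for n
    by (metis abs_summable_on_def infsetsum_def infsetsum_infsum)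
  have "integrable (count_space A) g"
    by (rule integrable_dominated_convergence[OF _ _ h' lim' bound']) auto
  hence g: "infsum g A = (\<integral>x. g x \<partial>count_space A)"
    by (metis abs_summable_on_def infsetsum_def infsetsum_infsum)
  show ?thesis
    unfolding f g by (rule integral_dominated_convergence[OF _ _ h' lim' bound']) auto
qed

lemma summable_on_power_abs_int:
  fixes r :: real
  assumes "0 \<le> r" "r < 1"
  shows "(\<lambda>n::int. r ^ nat \<bar>n\<bar>) summable_on UNIV"
proof -
  have geo: "(\<lambda>n::nat. r ^ n) summable_on UNIV"
    using assms by (intro summable_nonneg_imp_summable_on) (auto intro: summable_geometric)
  have 1: "(\<lambda>n::int. r ^ nat \<bar>n\<bar>) summable_on {0..}"
    by (rule iffD1[OF summable_on_reindex_bij_witness[of UNIV nat int] geo]) auto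
  have 2: "(\<lambda>n::int. r ^ nat \<bar>n\<bar>) summable_on {..0}"
    by (rule iffD1[OF summable_on_reindex_bij_witness[of UNIV "\<lambda>n. nat (- n)" "\<lambda>n. - int n"] geo]) auto
  have "{0..} \<union> {..0::int} = UNIV" by auto
  with summable_on_union[OF 1 2] show ?thesis by simp
qed

text \<open>Jacobi's theta constant as a function of the nome, equal to f(q, q). Natural exponents
  give the term of index 0 the value 1 also at \<open>q = 0\<close>.\<close>

definition theta3 :: "'a::{real_normed_field, banach} \<Rightarrow> 'a" where
  "theta3 q = (\<Sum>\<^sub>\<infinity>n\<in>(UNIV :: int set). q ^ nat (n\<^sup>2))"

lemma abs_le_square_int: "\<bar>n\<bar> \<le> (n::int)\<^sup>2"
  by (metis abs_ge_zero power2_abs self_le_power zero_less_numeral order_refl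
      zero_power2 le_less int_one_le_iff_zero_less)

lemma norm_theta3_term_le:
  fixes q :: "'a::real_normed_field"
  assumes "norm q < 1"
  shows "norm (q ^ nat (n\<^sup>2)) \<le> norm q ^ nat \<bar>n\<bar>"
  unfolding norm_power
  by (rule power_decreasing) (use assms abs_le_square_int[of n] in auto)

lemma theta3_abs_summable:
  fixes q :: "'a::real_normed_field"
  assumes "norm q < 1"
  shows "(\<lambda>n::int. q ^ nat (n\<^sup>2)) abs_summable_on A"
proof (rule Infinite_Sum.abs_summable_on_comparison_test')
  show "(\<lambda>n::int. norm q ^ nat \<bar>n\<bar>) summable_on A"
    using summable_on_power_abs_int[of "norm q"] assms summable_on_subset_banach by auto
qed (use assms norm_theta3_term_le in blast)

lemma theta3_summable:
  fixes q :: "'a::{real_normed_field, banach}"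
  assumes "norm q < 1"
  shows "(\<lambda>n::int. q ^ nat (n\<^sup>2)) summable_on A"
  using theta3_abs_summable[OF assms] by (rule abs_summable_summable)

lemma theta3_of_real:
  assumes "\<bar>q\<bar> < 1"
  shows "theta3 (of_real q :: complex) = of_real (theta3 q)"
  unfolding theta3_def of_real_power[symmetric] using theta3_summable[of q UNIV] assms
  by (intro infsumI has_sum_of_real) simp

lemma theta3_pos:
  fixes q :: real
  assumes "0 \<le> q" "q < 1"
  shows "theta3 q > 0"
proof -
  have "(\<Sum>n\<in>{0::int}. q ^ nat (n\<^sup>2)) \<le> theta3 q"
    unfolding theta3_def using assms by (intro finite_sum_le_infsum theta3_summable) auto
  thus ?thesis by simp
qed

section \<open>The product formula\<close>

fun gauss_binomial :: "'a::comm_ring_1 \<Rightarrow> nat \<Rightarrow> nat \<Rightarrow> 'a" where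
  "gauss_binomial p n 0 = 1"
| "gauss_binomial p 0 (Suc k) = 0"
| "gauss_binomial p (Suc n) (Suc k) =
     gauss_binomial p n (Suc k) + p ^ (n - k) * gauss_binomial p n k"

lemma gauss_binomial_eq_0: "n < k \<Longrightarrow> gauss_binomial p n k = 0"
  by (induction p n k rule: gauss_binomial.induct) auto

lemma gauss_binomial_self: "gauss_binomial p n n = 1"
  by (induction n) (auto simp: gauss_binomial_eq_0)

definition qprod :: "'a::comm_ring_1 \<Rightarrow> nat \<Rightarrow> 'a" where
  "qprod p n = (\<Prod>k<n. 1 - p ^ Suc k)"

lemma qprod_0 [simp]: "qprod p 0 = 1"
  and qprod_Suc: "qprod p (Suc n) = qprod p n * (1 - p ^ Suc n)"
  by (simp_all add: qprod_def)

text \<open>The q-analogue of the factorial formula, multiplied out so that it makes sense in any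
  commutative ring. With n = k + d + 1 the induction step rests on 1 - p^(n+1) = (1 - p^(d+1)) +
  p^(d+1) (1 - p^(k+1)), one summand for each term of the Pascal rule.\<close>

lemma gauss_binomial_qprod:
  "k \<le> n \<Longrightarrow> gauss_binomial p n k * (qprod p k * qprod p (n - k)) = qprod p n"
proof (induction p n k rule: gauss_binomial.induct)
  case (3 p n k)
  show ?case
  proof (cases "k = n")
    case True
    thus ?thesis by (simp add: gauss_binomial_eq_0 gauss_binomial_self)
  next
    case False
    with 3 have k: "Suc k \<le> n" by simp
    then obtain d where n: "n = Suc (k + d)"
      by (metis less_natE Suc_le_lessD)
    have IH1: "gauss_binomial p n (Suc k) * (qprod p (Suc k) * qprod p d) = qprod p n"
      using 3(1)[OF k] by (simp add: n)
    have IH2: "gauss_binomial p n k * (qprod p k * qprod p (Suc d)) = qprod p n"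
      using 3(2) k by (simp add: n)
    have "gauss_binomial p (Suc n) (Suc k) * (qprod p (Suc k) * qprod p (Suc n - Suc k))
      = (gauss_binomial p n (Suc k) * (qprod p (Suc k) * qprod p d)) * (1 - p ^ Suc d)
        + p ^ Suc d * (1 - p ^ Suc k) * (gauss_binomial p n k * (qprod p k * qprod p (Suc d)))"
      by (simp add: n qprod_Suc algebra_simps)
    also have "\<dots> = qprod p n * (1 - p ^ Suc n)"
      unfolding IH1 IH2 by (simp add: n algebra_simps power_add)
    finally show ?thesis by (simp add: qprod_Suc)
  qed
qed auto

lemma qprod_nonzero:
  fixes p :: "'a::real_normed_field"
  assumes "norm p < 1"
  shows "qprod p n \<noteq> 0"
proof -
  have "p ^ Suc k \<noteq> 1" for k
    using power_less_one_iff[of "norm p" "Suc k"] assms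
    by (metis norm_ge_zero norm_one norm_power less_irrefl zero_less_Suc)
  thus ?thesis by (auto simp: qprod_def)
qed

lemma gauss_binomial_sym:
  fixes p :: "'a::real_normed_field"
  assumes "norm p < 1" "k \<le> n"
  shows "gauss_binomial p n (n - k) = gauss_binomial p n k"
proof -
  have "gauss_binomial p n (n - k) * (qprod p k * qprod p (n - k)) = qprod p n"
    using gauss_binomial_qprod[of "n - k" n p] assms by (simp add: mult.commute)
  with gauss_binomial_qprod[OF assms(2), of p] qprod_nonzero[OF assms(1)] show ?thesis
    by (metis mult_cancel_right no_zero_divisors)
qed

text \<open>A finite form of Jacobi's triple product at z = 1. By the Pascal rule, raising
  \<open>m\<close> by one multiplies the sum by 1 + q^(2m+1). What remains is the case
  \<open>m = 0\<close>, which a symmetry reduces to the case \<open>n = 0\<close>.\<close>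

lemma gauss_binomial_theorem:
  fixes q :: "'a::real_normed_field"
  assumes "norm q < 1"
  shows "(\<Prod>k<m. 1 + q ^ (2 * k + 1)) * (\<Prod>k<n. 1 + q ^ (2 * k + 1)) =
    (\<Sum>r\<le>m + n. gauss_binomial (q\<^sup>2) (m + n) r * q ^ nat ((int r - int n)\<^sup>2))"
proof -
  define S where "S m n = (\<Sum>r\<le>m + n. gauss_binomial (q\<^sup>2) (m + n) r * q ^ nat ((int r - int n)\<^sup>2))"
    for m n
  have p: "norm (q\<^sup>2) < 1"
    using assms by (simp add: norm_power power_less_one_iff)
  have step: "S (Suc m) n = S m n * (1 + q ^ (2 * m + 1))" for m n
  proof -
    define M where "M = m + n"
    \<comment> \<open>The square grows by 2 (r - n) + 1, so together with 2 (m + n - r) the extra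
      exponent is 2 m + 1 for every \<open>r\<close>, and the factor leaves the sum.\<close>
    have e: "q ^ nat ((int (Suc r) - int n)\<^sup>2) * (q\<^sup>2) ^ (M - r)
        = q ^ nat ((int r - int n)\<^sup>2) * q ^ (2 * m + 1)" if "r \<le> M" for r
    proof -
      have "int (nat ((int (Suc r) - int n)\<^sup>2) + 2 * (M - r)) = int (nat ((int r - int n)\<^sup>2) + (2 * m + 1))"
        unfolding of_nat_add int_nat_eq if_P[OF zero_le_power2] using that
        by (simp add: M_def of_nat_diff power2_eq_square algebra_simps)
      hence "nat ((int (Suc r) - int n)\<^sup>2) + 2 * (M - r) = nat ((int r - int n)\<^sup>2) + (2 * m + 1)"
        by linarith
      thus ?thesis
        unfolding power_mult[symmetric] power_add[symmetric] by simp
    qed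
    have "S (Suc m) n = q ^ nat ((0 - int n)\<^sup>2)
        + (\<Sum>r\<le>M. gauss_binomial (q\<^sup>2) (Suc M) (Suc r) * q ^ nat ((int (Suc r) - int n)\<^sup>2))"
      by (simp add: S_def M_def sum.atMost_Suc_shift del: sum.atMost_Suc gauss_binomial.simps(3))
    also have "(\<Sum>r\<le>M. gauss_binomial (q\<^sup>2) (Suc M) (Suc r) * q ^ nat ((int (Suc r) - int n)\<^sup>2))
        = (\<Sum>r\<le>M. gauss_binomial (q\<^sup>2) M (Suc r) * q ^ nat ((int (Suc r) - int n)\<^sup>2))
         + (\<Sum>r\<le>M. gauss_binomial (q\<^sup>2) M r * (q ^ nat ((int (Suc r) - int n)\<^sup>2) * (q\<^sup>2) ^ (M - r)))"
      unfolding sum.distrib[symmetric] by (rule sum.cong) (simp_all add: algebra_simps)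
    also have "(\<Sum>r\<le>M. gauss_binomial (q\<^sup>2) M r * (q ^ nat ((int (Suc r) - int n)\<^sup>2) * (q\<^sup>2) ^ (M - r)))
        = S m n * q ^ (2 * m + 1)"
      unfolding S_def M_def[symmetric] sum_distrib_right
      by (rule sum.cong[OF refl], subst e) (simp_all add: mult.assoc)
    also have "q ^ nat ((0 - int n)\<^sup>2)
         + ((\<Sum>r\<le>M. gauss_binomial (q\<^sup>2) M (Suc r) * q ^ nat ((int (Suc r) - int n)\<^sup>2))
         + S m n * q ^ (2 * m + 1)) =
         (\<Sum>r\<le>Suc M. gauss_binomial (q\<^sup>2) M r * q ^ nat ((int r - int n)\<^sup>2)) + S m n * q ^ (2 * m + 1)"
      unfolding sum.atMost_Suc_shift by simp
    also have "(\<Sum>r\<le>Suc M. gauss_binomial (q\<^sup>2) M r * q ^ nat ((int r - int n)\<^sup>2)) = S m n"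
      by (simp add: gauss_binomial_eq_0 S_def M_def)
    finally show ?thesis by (simp add: algebra_simps)
  qed
  have left: "S m n = (\<Prod>k<m. 1 + q ^ (2 * k + 1)) * S 0 n" for m n
    by (induction m) (simp_all add: step algebra_simps)
  \<comment> \<open>Reversal r -> n - r carries the exponents (r - n)^2 to r^2 and preserves the
    Gaussian coefficients.\<close>
  have "S 0 n = S n 0"
    unfolding S_def
    by (rule sum.reindex_bij_witness[of _ "\<lambda>r. n - r" "\<lambda>r. n - r"])
       (auto simp: gauss_binomial_sym[OF p] of_nat_diff power2_commute)
  also have "\<dots> = (\<Prod>k<n. 1 + q ^ (2 * k + 1))"
    using left[of n 0] by (simp add: S_def)
  finally show ?thesis
    using left[of m n] by (simp add: S_def)
qed

section \<open>The infinite product for the theta series\<close>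

definition theta3_prod :: "'a::comm_ring_1 \<Rightarrow> nat \<Rightarrow> 'a" where
  "theta3_prod q N = (\<Prod>k<N. (1 - q ^ (2 * k + 2)) * (1 + q ^ (2 * k + 1))\<^sup>2)"

text \<open>That the limit is nonzero matters as much as convergence: it bounds the inverses of the
  partial products, which occur in the Gaussian coefficients.\<close>

lemma qprod_converges:
  fixes p :: "'a::{real_normed_field, banach, heine_borel}"
  assumes "norm p < 1"
  obtains L where "L \<noteq> 0" "qprod p \<longlonglongrightarrow> L"
proof -
  have "summable (\<lambda>k. norm p ^ Suc k)"
    using assms by (subst summable_Suc_iff) (auto intro: summable_geometric)
  hence "summable (\<lambda>k. norm ((1 - p ^ Suc k) - 1))"
    by (simp add: norm_power norm_mult)
  hence conv: "convergent_prod (\<lambda>k. 1 - p ^ Suc k)"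
    by (intro abs_convergent_prod_imp_convergent_prod summable_imp_abs_convergent_prod)
  have nz: "1 - p ^ Suc k \<noteq> 0" for k
    using qprod_nonzero[OF assms, of "Suc k"] by (simp add: qprod_def)
  have "(\<lambda>n. \<Prod>k\<le>n. 1 - p ^ Suc k) \<longlonglongrightarrow> prodinf (\<lambda>k. 1 - p ^ Suc k)"
    by (rule convergent_prod_LIMSEQ[OF conv])
  hence "(\<lambda>n. qprod p (Suc n)) \<longlonglongrightarrow> prodinf (\<lambda>k. 1 - p ^ Suc k)"
    by (simp add: qprod_def lessThan_Suc_atMost)
  hence "qprod p \<longlonglongrightarrow> prodinf (\<lambda>k. 1 - p ^ Suc k)"
    by (rule LIMSEQ_imp_Suc)
  with prodinf_nonzero[OF conv nz] that show ?thesis by blast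
qed

text \<open>Take \<open>m = n = N\<close> in the finite identity and multiply by \<open>P N\<close>.
  The coefficient of q^(j^2) becomes P(N) P(2N) / (P(N+j) P(N-j)), which tends to 1 for fixed
  \<open>j\<close> because \<open>P\<close> has a nonzero limit, and which is bounded uniformly in
  \<open>N\<close> and \<open>j\<close>. Dominated convergence does the rest.\<close>

theorem theta3_prod_tendsto:
  fixes q :: complex
  assumes q: "norm q < 1"
  shows "theta3_prod q \<longlonglongrightarrow> theta3 q"
proof -
  define P where "P = qprod (q\<^sup>2)"
  have p: "norm (q\<^sup>2) < 1"
    using q by (simp add: norm_power power_less_one_iff)
  obtain L where L: "L \<noteq> 0" "P \<longlonglongrightarrow> L"
    unfolding P_def by (rule qprod_converges[OF p])
  have nz: "P n \<noteq> 0" for n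
    unfolding P_def by (rule qprod_nonzero[OF p])
  have "convergent P" "convergent (\<lambda>n. inverse (P n))"
    using L tendsto_inverse convergent_def by blast+
  then obtain C D where C: "C > 0" "\<And>n. norm (P n) \<le> C" and D: "D > 0" "\<And>n. norm (inverse (P n)) \<le> D"
    by (meson BseqE convergent_imp_Bseq)
  \<comment> \<open>\<open>P N\<close> times the Gaussian coefficient with upper index 2N and lower
    index N + j, extended by 0 so that the index set does not depend on \<open>N\<close>.\<close>
  define c where "c N j = (if \<bar>j\<bar> \<le> int N then P N * P (2 * N) *
      (inverse (P (nat (int N + j))) * inverse (P (nat (int N - j)))) else 0)" for N j
  define f where "f N j = c N j * q ^ nat (j\<^sup>2)" for N j
  have prod: "theta3_prod q N = infsum (f N) UNIV" for N
  proof -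
    have "theta3_prod q N = P N * ((\<Prod>k<N. 1 + q ^ (2 * k + 1)) * (\<Prod>k<N. 1 + q ^ (2 * k + 1)))"
      unfolding theta3_prod_def prod.distrib P_def qprod_def
      by (simp add: power_mult[symmetric] prod_power_distrib flip: power2_eq_square power_Suc)
    also have "\<dots> = (\<Sum>r\<le>N + N. P N * gauss_binomial (q\<^sup>2) (N + N) r * q ^ nat ((int r - int N)\<^sup>2))"
      by (subst gauss_binomial_theorem[OF q]) (simp only: sum_distrib_left mult.assoc)
    also have "\<dots> = (\<Sum>j=-int N..int N. f N j)"
    proof (rule sum.reindex_bij_witness[of _ "\<lambda>j. nat (int N + j)" "\<lambda>r. int r - int N"])
      fix r assume r: "r \<in> {..N + N}"
      have "gauss_binomial (q\<^sup>2) (N + N) r * (P r * P (N + N - r)) = P (N + N)"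
        unfolding P_def using r by (intro gauss_binomial_qprod) auto
      hence g: "gauss_binomial (q\<^sup>2) (N + N) r = P (2 * N) * (inverse (P r) * inverse (P (N + N - r)))"
        using nz by (simp add: field_simps flip: mult_2)
      have "nat (int N - (int r - int N)) = N + N - r"
        using r by auto
      thus "f N (int r - int N) = P N * gauss_binomial (q\<^sup>2) (N + N) r * q ^ nat ((int r - int N)\<^sup>2)"
        using r unfolding f_def c_def g by auto
    qed auto
    also have "\<dots> = infsum (f N) UNIV"
      unfolding infsum_finite[OF finite_atLeastAtMost_int, symmetric]
      by (rule infsum_cong_neutral) (auto simp: f_def c_def)
    finally show ?thesis .
  qed
  have "(\<lambda>N. infsum (f N) UNIV) \<longlonglongrightarrow> infsum (\<lambda>j. q ^ nat (j\<^sup>2)) (UNIV :: int set)"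
  proof (rule infsum_dominated_convergence)
    fix j :: int
    have shift: "filterlim (\<lambda>N. nat (int N + i)) at_top sequentially" for i
      unfolding filterlim_at_top
    proof
      fix Z
      show "\<forall>\<^sub>F N in sequentially. Z \<le> nat (int N + i)"
        using eventually_ge_at_top[of "nat (int Z + \<bar>i\<bar>)"] by eventually_elim linarith
    qed
    have "filterlim (\<lambda>N. 2 * N) at_top (sequentially :: nat filter)"
      by (rule mult_nat_left_at_top) simp
    moreover have "filterlim (\<lambda>N. nat (int N + j)) at_top sequentially"
      "filterlim (\<lambda>N. nat (int N - j)) at_top sequentially"
      using shift[of j] shift[of "- j"] by simp_all
    ultimately have "(\<lambda>N. P N * P (2 * N) * (inverse (P (nat (int N + j))) * inverse (P (nat (int N - j)))))
        \<longlonglongrightarrow> L * L * (inverse L * inverse L)"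
      by (intro tendsto_mult tendsto_inverse L filterlim_compose[OF L(2)]) assumption+
    moreover have "\<forall>\<^sub>F N in sequentially. P N * P (2 * N) *
        (inverse (P (nat (int N + j))) * inverse (P (nat (int N - j)))) = c N j"
      using eventually_ge_at_top[of "nat \<bar>j\<bar>"] by eventually_elim (auto simp: c_def)
    ultimately have "(\<lambda>N. c N j) \<longlonglongrightarrow> L * L * (inverse L * inverse L)"
      by (rule Lim_transform_eventually)
    hence "(\<lambda>N. f N j) \<longlonglongrightarrow> L * L * (inverse L * inverse L) * q ^ nat (j\<^sup>2)"
      unfolding f_def by (intro tendsto_mult tendsto_const)
    thus "(\<lambda>N. f N j) \<longlonglongrightarrow> q ^ nat (j\<^sup>2)"
      using L(1) by (simp add: field_simps)
  next
    fix N and j :: int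
    have "norm (c N j) \<le> C * C * (D * D)"
      using C D unfolding c_def by (auto simp: norm_mult intro!: mult_mono)
    thus "norm (f N j) \<le> C * C * (D * D) * norm (q ^ nat (j\<^sup>2))"
      unfolding f_def norm_mult by (rule mult_right_mono) auto
  next
    show "(\<lambda>j::int. C * C * (D * D) * norm (q ^ nat (j\<^sup>2))) summable_on UNIV"
      by (intro summable_on_cmult_right theta3_abs_summable q)
  qed
  thus ?thesis
    unfolding theta3_def prod[symmetric] .
qed

section \<open>The cubic relation\<close>

lemma prod_lessThan_mult3:
  fixes f :: "nat \<Rightarrow> 'a::comm_monoid_mult"
  shows "(\<Prod>k<3 * N. f k) = (\<Prod>k<N. f (3 * k) * f (3 * k + 1) * f (3 * k + 2))"
  by (induction N) (simp_all add: numeral_3_eq_3 mult_ac)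

lemma cube_root_unity_identities:
  fixes w y :: "'a::idom"
  assumes "w\<^sup>2 + w + 1 = 0"
  shows "(1 - y) * (1 - w * y) * (1 - w\<^sup>2 * y) = 1 - y ^ 3"
    and "(1 + y) * (1 + w * y) * (1 + w\<^sup>2 * y) = 1 + y ^ 3"
  using assms by algebra+

text \<open>Let a(i) = x^(6k+i) in the k-th block of three factors. For i prime to 3, the factors
  for x, w x and w^2 x multiply to a factor of the product for x^3. For i = 3 and i = 6 they do not
  see \<open>w\<close> and give cubes of factors of the shorter product for x^3, while x^9 supplies
  the factors still missing from the longer one. Taking 3N and N factors makes the identity exact at
  each finite stage.\<close>

lemma theta3_prod_cubic:
  fixes w x :: "'a::idom"
  assumes w: "w\<^sup>2 + w + 1 = 0"
  shows "theta3_prod x (3 * N) * theta3_prod (w * x) (3 * N) * theta3_prod (w\<^sup>2 * x) (3 * N) *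
      theta3_prod (x ^ 9) N = theta3_prod (x ^ 3) (3 * N) * theta3_prod (x ^ 3) N ^ 3"
proof -
  have w3: "w ^ 3 = 1"
    using w by algebra
  define g where "g y k = (1 - y ^ (2 * k + 2)) * (1 + y ^ (2 * k + 1))\<^sup>2" for y :: 'a and k
  have tp: "theta3_prod y N = (\<Prod>k<N. g y k)" for y N
    by (simp add: theta3_prod_def g_def)
  have tp3: "theta3_prod y (3 * N) = (\<Prod>k<N. g y (3 * k) * g y (3 * k + 1) * g y (3 * k + 2))" for y N
    unfolding tp by (rule prod_lessThan_mult3)
  have wp: "w ^ (3 * j + i) = w ^ i" for i j
    by (simp add: power_add power_mult w3)
  have main: "(g x (3 * k) * g x (3 * k + 1) * g x (3 * k + 2)) *
      (g (w * x) (3 * k) * g (w * x) (3 * k + 1) * g (w * x) (3 * k + 2)) *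
      (g (w\<^sup>2 * x) (3 * k) * g (w\<^sup>2 * x) (3 * k + 1) * g (w\<^sup>2 * x) (3 * k + 2)) * g (x ^ 9) k =
      (g (x ^ 3) (3 * k) * g (x ^ 3) (3 * k + 1) * g (x ^ 3) (3 * k + 2)) * g (x ^ 3) k ^ 3" for k
  proof -
    define a where "a i = x ^ (6 * k + i)" for i
    have e: "2 * (3 * k) + 2 = 6 * k + 2" "2 * (3 * k) + 1 = 6 * k + 1"
      "2 * (3 * k + 1) + 2 = 6 * k + 4" "2 * (3 * k + 1) + 1 = 6 * k + 3"
      "2 * (3 * k + 2) + 2 = 6 * k + 6" "2 * (3 * k + 2) + 1 = 6 * k + 5"
      by simp_all
    have ge: "g y (3 * k) = (1 - y ^ (6 * k + 2)) * (1 + y ^ (6 * k + 1))\<^sup>2"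
      "g y (3 * k + 1) = (1 - y ^ (6 * k + 4)) * (1 + y ^ (6 * k + 3))\<^sup>2"
      "g y (3 * k + 2) = (1 - y ^ (6 * k + 6)) * (1 + y ^ (6 * k + 5))\<^sup>2" for y :: 'a
      by (simp_all only: g_def e)
    have pw: "(w * x) ^ (6 * k + i) = w ^ i * a i" "(w\<^sup>2 * x) ^ (6 * k + i) = w ^ (2 * i) * a i"
      "(x ^ 3) ^ (6 * k + i) = a i ^ 3" for i
      using wp[of "2 * k" i] wp[of "4 * k" "2 * i"]
      by (simp_all add: power_mult_distrib a_def algebra_simps flip: power_mult)
    have ws: "w ^ 1 = w" "w ^ 3 = 1" "w ^ 4 = w" "w ^ 5 = w\<^sup>2" "w ^ 6 = 1" "w ^ (2 * 1) = w\<^sup>2"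
      "w ^ (2 * 2) = w" "w ^ (2 * 3) = 1" "w ^ (2 * 4) = w\<^sup>2" "w ^ (2 * 5) = w" "w ^ (2 * 6) = 1"
      using wp[of 1 0] wp[of 1 1] wp[of 1 2] wp[of 2 0] wp[of 2 2] wp[of 3 1] wp[of 4 0] by simp_all
    note gx = ge[of x, folded a_def]
    note gw = ge[of "w * x", unfolded pw ws mult_1]
    note gww = ge[of "w\<^sup>2 * x", unfolded pw ws mult_1]
    have "g (x ^ 3) k = (1 - a 6) * (1 + a 3)\<^sup>2"
      "g (x ^ 9) k = (1 - a 6 ^ 3) * (1 + a 3 ^ 3)\<^sup>2"
      unfolding g_def a_def power_mult[symmetric] by (simp_all add: algebra_simps)
    note g3 = this ge[of "x ^ 3", unfolded pw]
    have c1: "(1 + a i) * (1 + w * a i) * (1 + w\<^sup>2 * a i) = 1 + a i ^ 3" for i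
      by (rule cube_root_unity_identities[OF w])
    have c2: "(1 - a i) * (1 - w * a i) * (1 - w\<^sup>2 * a i) = 1 - a i ^ 3" for i
      by (rule cube_root_unity_identities[OF w])
    show ?thesis
      unfolding gx gw gww g3 c1[of 1, symmetric] c1[of 5, symmetric] c2[of 2, symmetric] c2[of 4, symmetric]
      by (simp only: power_mult_distrib power2_eq_square power3_eq_cube mult_ac)
  qed
  show ?thesis
    unfolding tp3 tp[of _ N] prod.distrib[symmetric] prod_power_distrib main ..
qed

theorem theta3_cubic:
  fixes w x :: complex
  assumes w: "w\<^sup>2 + w + 1 = 0" and x: "norm x < 1"
  shows "theta3 x * theta3 (w * x) * theta3 (w\<^sup>2 * x) * theta3 (x ^ 9) = theta3 (x ^ 3) ^ 4"
proof -
  have "w ^ 3 = 1"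
    using w by algebra
  hence nw: "norm w = 1"
    by (metis power_eq_1_iff zero_neq_numeral)
  have n: "norm (w * x) < 1" "norm (w\<^sup>2 * x) < 1" "norm (x ^ 3) < 1" "norm (x ^ 9) < 1"
    using x by (simp_all add: norm_mult norm_power nw power_less_one_iff)
  have 3: "filterlim (\<lambda>N. 3 * N) at_top (sequentially :: nat filter)"
    by (rule mult_nat_left_at_top) simp
  note lim = theta3_prod_tendsto filterlim_compose[OF theta3_prod_tendsto 3]
  have "(\<lambda>N. theta3_prod x (3 * N) * theta3_prod (w * x) (3 * N) * theta3_prod (w\<^sup>2 * x) (3 * N) *
      theta3_prod (x ^ 9) N) \<longlonglongrightarrow> theta3 x * theta3 (w * x) * theta3 (w\<^sup>2 * x) * theta3 (x ^ 9)"
    by (intro tendsto_mult lim n x)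
  moreover have "(\<lambda>N. theta3_prod (x ^ 3) (3 * N) * theta3_prod (x ^ 3) N ^ 3)
      \<longlonglongrightarrow> theta3 (x ^ 3) * theta3 (x ^ 3) ^ 3"
    by (intro tendsto_mult tendsto_power lim n)
  ultimately show ?thesis
    unfolding theta3_prod_cubic[OF w] by (simp add: LIMSEQ_unique eval_nat_numeral)
qed

text \<open>
  Splitting the sum by residues modulo 3 turns the product over the cube roots of unity into
  \<open>A\<^sup>3 + B\<^sup>3\<close>, where \<open>A\<close> and \<open>B\<close> collect the terms with exponent \<open>0\<close> and \<open>1\<close> modulo 3.
\<close>

definition theta3_nontriple :: "'a::{real_normed_field, banach} \<Rightarrow> 'a" where
  "theta3_nontriple x = (\<Sum>\<^sub>\<infinity>n\<in>{n::int. \<not> 3 dvd n}. x ^ nat (n\<^sup>2))"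

lemma infsum_triple:
  "(\<Sum>\<^sub>\<infinity>n\<in>{n::int. 3 dvd n}. x ^ nat (n\<^sup>2)) = theta3 (x ^ 9)"
  unfolding theta3_def
proof (rule infsum_reindex_bij_witness[of _ "\<lambda>n. 3 * n" "\<lambda>n. n div 3"])
  fix n :: int assume "n \<in> {n. 3 dvd n}"
  then obtain m where "n = 3 * m" by auto
  thus "(x ^ 9) ^ nat ((n div 3)\<^sup>2) = x ^ nat (n\<^sup>2)"
    by (simp add: power_mult_distrib nat_mult_distrib flip: power_mult)
qed auto

lemma square_mod3: "\<not> 3 dvd n \<Longrightarrow> \<exists>m. nat ((n::int)\<^sup>2) = 3 * m + 1"
proof -
  assume "\<not> 3 dvd n"
  hence "n = 3 * (n div 3) + 1 \<or> n = 3 * (n div 3) + 2" by presburger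
  then obtain k where "n = 3 * k + 1 \<or> n = 3 * k + 2" by blast
  hence "\<exists>m. n\<^sup>2 = 3 * m + 1"
  proof
    assume "n = 3 * k + 1"
    hence "n\<^sup>2 = 3 * (3 * k\<^sup>2 + 2 * k) + 1" by algebra
    thus ?thesis ..
  next
    assume "n = 3 * k + 2"
    hence "n\<^sup>2 = 3 * (3 * k\<^sup>2 + 4 * k + 1) + 1" by algebra
    thus ?thesis ..
  qed
  then obtain m where m: "n\<^sup>2 = 3 * m + 1" by blast
  moreover have "0 \<le> n\<^sup>2" by simp
  ultimately have "nat (n\<^sup>2) = 3 * nat m + 1" by linarith
  thus ?thesis ..
qed

text \<open>A square is 0 or 1 modulo 3, according to whether 3 divides its root, so
  \<open>w\<close> leaves the first class of terms alone and multiplies the second by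
  \<open>w\<close>. The case w = 1 is included because the plain splitting is used as well.\<close>

lemma theta3_split:
  fixes w x :: complex
  assumes w: "w ^ 3 = 1" and x: "norm x < 1"
  shows "theta3 (w * x) = theta3 (x ^ 9) + w * theta3_nontriple x"
proof -
  have w': "norm w = 1"
    using w by (metis power_eq_1_iff zero_neq_numeral)
  have wx: "norm (w * x) < 1"
    using x by (simp add: norm_mult w')
  have "UNIV = {n::int. 3 dvd n} \<union> {n. \<not> 3 dvd n}" by auto
  hence "theta3 (w * x) = (\<Sum>\<^sub>\<infinity>n\<in>{n::int. 3 dvd n}. (w * x) ^ nat (n\<^sup>2)) +
      theta3_nontriple (w * x)"
    unfolding theta3_nontriple_def theta3_def
    using infsum_Un_disjoint[OF theta3_summable[OF wx] theta3_summable[OF wx],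
        of "{n. 3 dvd n}" "{n. \<not> 3 dvd n}"] by auto
  also have "(\<Sum>\<^sub>\<infinity>n\<in>{n::int. 3 dvd n}. (w * x) ^ nat (n\<^sup>2)) = theta3 (x ^ 9)"
    unfolding infsum_triple using power_mult[of w 3 3] w by (simp add: power_mult_distrib)
  also have "theta3_nontriple (w * x) = w * theta3_nontriple x"
    unfolding theta3_nontriple_def infsum_cmult_right'[symmetric]
  proof (rule infsum_cong)
    fix n :: int assume "n \<in> {n. \<not> 3 dvd n}"
    then obtain m where "nat (n\<^sup>2) = 3 * m + 1" using square_mod3 by blast
    thus "(w * x) ^ nat (n\<^sup>2) = w * x ^ nat (n\<^sup>2)"
      by (simp add: power_mult_distrib power_add power_mult w)
  qed
  finally show ?thesis .
qed

theorem theta3_cubic_relation: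
  fixes x :: complex
  assumes x: "norm x < 1"
  shows "theta3 (x ^ 9) * (theta3 (x ^ 9) ^ 3 + theta3_nontriple x ^ 3) = theta3 (x ^ 3) ^ 4"
proof -
  define w :: complex where "w = Complex (- 1 / 2) (sqrt 3 / 2)"
  have w: "w\<^sup>2 + w + 1 = 0"
    by (simp add: w_def complex_eq_iff power2_eq_square)
  hence w3: "w ^ 3 = 1" "(w\<^sup>2) ^ 3 = 1" by algebra+
  define A B where "A = theta3 (x ^ 9)" and "B = theta3_nontriple x"
  have "(A + B) * (A + w * B) * (A + w\<^sup>2 * B) * A = theta3 (x ^ 3) ^ 4"
    using theta3_cubic[OF w x] theta3_split[of 1, OF _ x] theta3_split[OF w3(1) x]
      theta3_split[OF w3(2) x] by (simp add: A_def B_def)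
  moreover have "(A + B) * (A + w * B) * (A + w\<^sup>2 * B) * A = A * (A ^ 3 + B ^ 3)"
    using w by algebra
  ultimately show ?thesis
    by (simp add: A_def B_def)
qed

section \<open>The inversion formula\<close>

lemma sum_cis_roots_of_unity:
  fixes r :: int
  shows "(\<Sum>j=-int L..int L. cis (2 * pi * of_int (r * j) / real (2 * L + 1))) =
    (if int (2 * L + 1) dvd r then of_nat (2 * L + 1) else 0)"
proof -
  define l where "l = 2 * L + 1"
  have l: "real l > 0" "2 * real L + 1 = real l" by (simp_all add: l_def)
  show ?thesis
    unfolding l_def[symmetric]
  proof (cases "int l dvd r")
    case True
    then obtain s where s: "r = int l * s" by auto
    have "cis (2 * pi * of_int (r * j) / l) = 1" for j
    proof -
      have "2 * pi * of_int (r * j) / l = 2 * pi * of_int (s * j)"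
        using l(1) by (simp add: s)
      thus ?thesis by (metis Ints_of_int cis_multiple_2pi)
    qed
    thus "(\<Sum>j=-int L..int L. cis (2 * pi * of_int (r * j) / real l)) = (if int l dvd r then of_nat l else 0)"
      using True by (simp add: l_def)
  next
    case False
    define z where "z = cis (2 * pi * r / l)"
    have z1: "z \<noteq> 1"
    proof
      assume "z = 1"
      hence "cos (2 * pi * r / l) = 1"
        by (metis z_def Re_complex_of_real cis.sel(1) of_real_1)
      then obtain n :: int where "2 * pi * r / l = of_int n * 2 * pi"
        unfolding cos_one_2pi_int by blast
      hence "of_int r = (of_int (n * int l) :: real)"
        using l by (simp add: field_simps)
      hence "r = n * int l" by (simp only: of_int_eq_iff)
      with False show False by simp
    qed
    have "z ^ l = cis (2 * pi * r)"
      using l(1) by (simp add: z_def Complex.DeMoivre)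
    also have "\<dots> = 1" by (simp add: cis_multiple_2pi)
    finally have zl: "z ^ l = 1" .
    \<comment> \<open>Shifting \<open>j\<close> by \<open>L\<close> turns the symmetric range into
      the exponents 0 to 2L of a geometric sum, whose ratio \<open>z\<close> is an l-th root of
      unity different from 1.\<close>
    have "(\<Sum>j=-int L..int L. cis (2 * pi * of_int (r * j) / l)) =
        (\<Sum>k<l. cis (- (2 * pi * r * L / l)) * z ^ k)"
    proof (rule sum.reindex_bij_witness[of _ "\<lambda>k. int k - int L" "\<lambda>j. nat (j + int L)"])
      fix j assume j: "j \<in> {- int L..int L}"
      hence "real (nat (j + int L)) = of_int j + real L" by simp
      hence "- (2 * pi * r * L / l) + real (nat (j + int L)) * (2 * pi * r / l) =
          2 * pi * of_int (r * j) / l"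
        using l(1) by (simp add: field_simps)
      thus "cis (- (2 * pi * r * L / l)) * z ^ nat (j + int L) = cis (2 * pi * of_int (r * j) / l)"
        unfolding z_def Complex.DeMoivre cis_mult by (simp only:)
    qed (auto simp: l_def)
    also have "\<dots> = 0"
      unfolding sum_distrib_left[symmetric] using geometric_sum[OF z1, of l] zl by simp
    finally show "(\<Sum>j=-int L..int L. cis (2 * pi * of_int (r * j) / real l)) = (if int l dvd r then of_nat l else 0)"
      using False by simp
  qed
qed

text \<open>The coefficient of z^(2r) in (z + 1/z)^(2m). For r < -m, \<open>nat\<close> would return
  0 and the binomial coefficient 1, hence the case distinction.\<close>

definition centered_binomial :: "nat \<Rightarrow> int \<Rightarrow> nat" where
  "centered_binomial m r = (if \<bar>r\<bar> \<le> int m then (2 * m) choose nat (int m + r) else 0)"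

lemma two_cos_power_expansion:
  "complex_of_real ((2 * cos x) ^ (2 * m)) =
    (\<Sum>r=-int m..int m. of_nat (centered_binomial m r) * cis (2 * of_int r * x))"
proof -
  have "complex_of_real (2 * cos x) = cis x + cis (- x)"
    by (simp add: complex_eq_iff)
  hence "complex_of_real ((2 * cos x) ^ (2 * m)) = (cis x + cis (- x)) ^ (2 * m)"
    by (simp only: of_real_power)
  also have "\<dots> = (\<Sum>k\<le>2 * m. of_nat ((2 * m) choose k) * cis x ^ k * cis (- x) ^ (2 * m - k))"
    by (rule binomial_ring)
  also have "\<dots> = (\<Sum>r=-int m..int m. of_nat (centered_binomial m r) * cis (2 * of_int r * x))"
  proof (rule sum.reindex_bij_witness[of _ "\<lambda>r. nat (int m + r)" "\<lambda>k. int k - int m"])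
    fix k assume k: "k \<in> {..2 * m}"
    hence "of_nat (centered_binomial m (int k - int m)) = (of_nat ((2 * m) choose k) :: complex)"
      by (auto simp: centered_binomial_def)
    moreover have "real k * x + real (2 * m - k) * (- x) = 2 * of_int (int k - int m) * x"
      using k by (simp add: of_nat_diff algebra_simps)
    hence "cis x ^ k * cis (- x) ^ (2 * m - k) = cis (2 * of_int (int k - int m) * x)"
      unfolding Complex.DeMoivre cis_mult by (simp only:)
    ultimately show "of_nat (centered_binomial m (int k - int m)) * cis (2 * of_int (int k - int m) * x) =
        of_nat ((2 * m) choose k) * cis x ^ k * cis (- x) ^ (2 * m - k)"
      by (simp add: mult.assoc)
  qed auto
  finally show ?thesis .
qed

text \<open>Expand the even power of the cosine into exponentials and sum over \<open>j\<close>
  first: orthogonality of the roots of unity keeps the indices divisible by 2L + 1. After scaling,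
  both sides converge to theta series.\<close>

lemma sum_cos_powers:
  "(\<Sum>j=-int L..int L. (2 * cos (pi * of_int j / real (2 * L + 1))) ^ (2 * m)) =
    real (2 * L + 1) * (\<Sum>\<^sub>\<infinity>k\<in>UNIV. real (centered_binomial m (k * int (2 * L + 1))))"
proof -
  define l where "l = 2 * L + 1"
  have "complex_of_real (\<Sum>j=-int L..int L. (2 * cos (pi * of_int j / l)) ^ (2 * m)) =
      (\<Sum>j=-int L..int L. \<Sum>r=-int m..int m.
        of_nat (centered_binomial m r) * cis (2 * pi * of_int (r * j) / l))"
    unfolding of_real_sum two_cos_power_expansion by (simp add: mult_ac)
  also have "\<dots> = (\<Sum>r=-int m..int m. of_nat (centered_binomial m r) *
      (\<Sum>j=-int L..int L. cis (2 * pi * of_int (r * j) / l)))"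
    by (subst sum.swap) (simp add: sum_distrib_left)
  also have "\<dots> = (\<Sum>r=-int m..int m. of_nat (centered_binomial m r) * (if int l dvd r then of_nat l else 0))"
    unfolding l_def sum_cis_roots_of_unity ..
  also have "\<dots> = complex_of_real (real l * (\<Sum>r\<in>{r\<in>{-int m..int m}. int l dvd r}. real (centered_binomial m r)))"
    by (subst sum.inter_filter)
       (simp_all add: sum_distrib_left mult.commute if_distrib[of of_real] if_distrib[of "(*) _"] cong: if_cong)
  finally have "(\<Sum>j=-int L..int L. (2 * cos (pi * of_int j / l)) ^ (2 * m)) =
      l * (\<Sum>r\<in>{r\<in>{-int m..int m}. int l dvd r}. real (centered_binomial m r))"
    unfolding of_real_eq_iff by simp
  also have "(\<Sum>r\<in>{r\<in>{-int m..int m}. int l dvd r}. real (centered_binomial m r)) =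
      (\<Sum>\<^sub>\<infinity>r\<in>{r. int l dvd r}. real (centered_binomial m r))"
  proof -
    have "finite {r \<in> {-int m..int m}. int l dvd r}"
      by (rule finite_subset[of _ "{-int m..int m}"]) auto
    from infsum_finite[OF this, symmetric] show ?thesis
      by (rule trans) (auto intro!: infsum_cong_neutral simp: centered_binomial_def split: if_splits)
  qed
  also have "\<dots> = (\<Sum>\<^sub>\<infinity>k\<in>UNIV. real (centered_binomial m (k * int l)))"
    by (rule infsum_reindex_bij_witness[of _ "\<lambda>k. k * int l" "\<lambda>r. r div int l"]) (auto simp: l_def)
  finally show ?thesis
    unfolding l_def[symmetric] .
qed

section \<open>Gaussian estimates for cosine powers and central binomial coefficients\<close>

lemma exp_bounds_one_minus:
  fixes y :: real
  assumes "y < 1"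
  shows "exp (- (y / (1 - y))) \<le> 1 - y" "1 - y \<le> exp (- y)"
proof -
  \<comment> \<open>Both bounds are 1 + z \<le> exp z, first at z = y / (1 - y) followed by
    inversion, then at z = -y.\<close>
  have "1 / (1 - y) = 1 + y / (1 - y)"
    using assms by (simp add: field_simps)
  also have "\<dots> \<le> exp (y / (1 - y))" by (rule exp_ge_add_one_self)
  finally show "exp (- (y / (1 - y))) \<le> 1 - y"
    using assms by (simp add: exp_minus field_simps)
  show "1 - y \<le> exp (- y)"
    using exp_ge_add_one_self[of "- y"] by simp
qed

text \<open>Put y = sin^2 x, so that 1 - y = cos^2 x and y / (1 - y) = tan^2 x. For small x both
  exponents behave like -m x^2.\<close>

lemma cos_power_bounds:
  assumes "cos x \<noteq> 0"
  shows "exp (- (real m * (tan x)\<^sup>2)) \<le> cos x ^ (2 * m)" "cos x ^ (2 * m) \<le> exp (- (real m * (sin x)\<^sup>2))"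
proof -
  have y: "(sin x)\<^sup>2 < 1" "1 - (sin x)\<^sup>2 = (cos x)\<^sup>2"
    using assms by (simp_all add: sin_squared_eq)
  have t: "(sin x)\<^sup>2 / (1 - (sin x)\<^sup>2) = (tan x)\<^sup>2"
    by (simp add: y tan_def power_divide)
  have "exp (- (tan x)\<^sup>2) ^ m \<le> ((cos x)\<^sup>2) ^ m"
    using exp_bounds_one_minus(1)[OF y(1)] unfolding t unfolding y(2) by (intro power_mono) auto
  thus "exp (- (real m * (tan x)\<^sup>2)) \<le> cos x ^ (2 * m)"
    by (simp add: power_mult exp_of_nat_mult[symmetric])
  have "((cos x)\<^sup>2) ^ m \<le> exp (- (sin x)\<^sup>2) ^ m"
    using exp_bounds_one_minus(2)[OF y(1)] unfolding y by (intro power_mono) auto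
  thus "cos x ^ (2 * m) \<le> exp (- (real m * (sin x)\<^sup>2))"
    by (simp add: power_mult exp_of_nat_mult[symmetric])
qed

lemma binomial_central_step:
  assumes "r < m"
  shows "real ((2 * m) choose (m + Suc r)) = real ((2 * m) choose (m + r)) * (1 - (2 * r + 1) / (m + r + 1))"
proof -
  have "Suc (m + r) * ((2 * m) choose Suc (m + r)) = (2 * m - (m + r)) * ((2 * m) choose (m + r))"
    by (metis binomial_absorb_comp binomial_absorption)
  from arg_cong[OF this, of real]
  have "real (m + r + 1) * real ((2 * m) choose (m + Suc r)) = (real m - real r) * real ((2 * m) choose (m + r))"
    using assms by (simp add: of_nat_diff add_ac distrib_right)
  thus ?thesis
    by (simp add: field_simps)
qed

text \<open>Multiply the ratios of consecutive coefficients. Freezing every denominator at its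
  smallest value m - r leaves the exponents (2i + 1) / (m - r), and the odd numbers add up to r^2.
  The upper bound works in the same way with m + r.\<close>

lemma binomial_central_lower:
  assumes "r < m"
  shows "real ((2 * m) choose m) * exp (- ((real r)\<^sup>2 / (real m - real r))) \<le> real ((2 * m) choose (m + r))"
proof -
  have "real ((2 * m) choose m) * exp (- ((real i)\<^sup>2 / (real m - real r))) \<le> real ((2 * m) choose (m + i))"
    if "i \<le> r" for i
    using that
  proof (induction i)
    case (Suc i)
    define y where "y = (2 * real i + 1) / (m + i + 1)"
    have im: "i < m" using Suc assms by simp
    have y: "y < 1" using im by (simp add: y_def)
    have "1 - y = (real m - real i) / (m + i + 1)"
      by (simp add: y_def field_simps)
    hence "y / (1 - y) = (2 * real i + 1) / (real m - real i)"
      by (simp add: y_def)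
    also have "\<dots> \<le> (2 * real i + 1) / (real m - real r)"
      using Suc assms by (intro divide_left_mono) auto
    finally have "exp (- ((2 * real i + 1) / (real m - real r))) \<le> 1 - y"
      using exp_bounds_one_minus(1)[OF y] by (smt (verit) exp_le_cancel_iff)
    hence "real ((2 * m) choose m) * exp (- ((real i)\<^sup>2 / (real m - real r))) *
        exp (- ((2 * real i + 1) / (real m - real r))) \<le> real ((2 * m) choose (m + i)) * (1 - y)"
      using Suc by (intro mult_mono) auto
    also have "\<dots> = real ((2 * m) choose (m + Suc i))"
      unfolding binomial_central_step[OF im] y_def by simp
    moreover have "exp (- ((real i)\<^sup>2 / (real m - real r))) * exp (- ((2 * real i + 1) / (real m - real r))) =
        exp (- ((real (Suc i))\<^sup>2 / (real m - real r)))"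
      by (simp flip: exp_add add: add_divide_distrib[symmetric] power2_eq_square algebra_simps)
    ultimately show ?case
      by (simp add: mult.assoc)
  qed simp
  thus ?thesis by simp
qed

lemma binomial_central_upper:
  assumes "r \<le> m"
  shows "real ((2 * m) choose (m + r)) \<le> real ((2 * m) choose m) * exp (- ((real r)\<^sup>2 / (real m + real r)))"
proof -
  have "real ((2 * m) choose (m + i)) \<le> real ((2 * m) choose m) * exp (- ((real i)\<^sup>2 / (real m + real r)))"
    if "i \<le> r" for i
    using that
  proof (induction i)
    case (Suc i)
    define y where "y = (2 * real i + 1) / (m + i + 1)"
    have im: "i < m" using Suc assms by simp
    have y: "y < 1" using im by (simp add: y_def)
    have "(2 * real i + 1) / (real m + real r) \<le> y"
      unfolding y_def using Suc im by (intro divide_left_mono) auto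
    hence "1 - y \<le> exp (- ((2 * real i + 1) / (real m + real r)))"
      using exp_bounds_one_minus(2)[OF y] by (smt (verit) exp_le_cancel_iff)
    hence "real ((2 * m) choose (m + i)) * (1 - y) \<le> real ((2 * m) choose m) * exp (- ((real i)\<^sup>2 / (real m + real r))) *
        exp (- ((2 * real i + 1) / (real m + real r)))"
      using Suc y by (intro mult_mono) auto
    moreover have "exp (- ((real i)\<^sup>2 / (real m + real r))) * exp (- ((2 * real i + 1) / (real m + real r))) =
        exp (- ((real (Suc i))\<^sup>2 / (real m + real r)))"
      by (simp flip: exp_add add: add_divide_distrib[symmetric] power2_eq_square algebra_simps)
    moreover have "real ((2 * m) choose (m + Suc i)) = real ((2 * m) choose (m + i)) * (1 - y)"
      unfolding binomial_central_step[OF im] y_def by simp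
    ultimately show ?case
      by (simp add: mult.assoc)
  qed simp
  thus ?thesis by simp
qed

lemma centered_binomial_abs: "centered_binomial m r = (if nat \<bar>r\<bar> \<le> m then (2 * m) choose (m + nat \<bar>r\<bar>) else 0)"
proof (cases "r \<ge> 0")
  case False
  then obtain k where r: "r = - int k"
    by (metis nonpos_int_cases nle_le)
  have "2 * m choose (m - k) = 2 * m choose (m + k)" if "k \<le> m"
    using binomial_symmetric[of "m - k" "2 * m"] that by (simp add: mult_2)
  thus ?thesis
    by (auto simp: centered_binomial_def r nat_diff_distrib)
qed (auto simp: centered_binomial_def nat_add_distrib)

text \<open>W(m)^2 (2m + 1) is the reciprocal of Wallis' partial product, whose limit is pi /
  2.\<close>

lemma central_binomial_asymptotics:
  "(\<lambda>m. sqrt (pi * m) * ((2 * m) choose m) / 4 ^ m) \<longlonglongrightarrow> 1"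
proof -
  define W where "W m = real ((2 * m) choose m) / 4 ^ m" for m
  have Wsuc: "W (Suc m) = W m * (2 * m + 1) / (2 * m + 2)" for m
  proof -
    have "real (Suc m * (Suc m * ((2 * Suc m) choose Suc m))) = real ((2 * m + 2) * ((2 * m + 1) * ((2 * m) choose m)))"
    proof (rule arg_cong[of _ _ real])
      have h: "Suc m * ((2 * m + 1) choose m) = (2 * m + 1) * ((2 * m) choose m)"
        using binomial_absorb_comp[of "2 * m + 1" m] by simp
      have "Suc m * (Suc m * ((2 * Suc m) choose Suc m)) = Suc m * ((2 * m + 2) * ((2 * m + 1) choose m))"
        using Suc_times_binomial_eq[of "2 * m + 1" m] by simp
      also have "\<dots> = (2 * m + 2) * ((2 * m + 1) * ((2 * m) choose m))"
        by (metis h mult.left_commute)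
      finally show "Suc m * (Suc m * ((2 * Suc m) choose Suc m)) = (2 * m + 2) * ((2 * m + 1) * ((2 * m) choose m))" .
    qed
    moreover define C D where "C = real ((2 * Suc m) choose Suc m)" and "D = real ((2 * m) choose m)"
    ultimately have "(real m + 1) * ((real m + 1) * C) = (2 * real m + 2) * ((2 * real m + 1) * D)"
      unfolding of_nat_mult by (simp add: add_ac)
    hence "(real m + 1) * ((real m + 1) * C) = (real m + 1) * (2 * ((2 * real m + 1) * D))"
      by (simp add: algebra_simps)
    hence C: "(real m + 1) * C = 2 * ((2 * real m + 1) * D)"
      by (subst (asm) mult_cancel_left) auto
    have "C / 4 ^ Suc m = (real m + 1) * C / ((real m + 1) * (4 * 4 ^ m))"
      by simp
    also have "\<dots> = D / 4 ^ m * (2 * m + 1) / (2 * m + 2)"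
      unfolding C by (simp add: divide_simps) (simp add: algebra_simps)
    finally show ?thesis
      unfolding W_def C_def[symmetric] D_def[symmetric] .
  qed
  have W: "(W m)\<^sup>2 * (2 * m + 1) * (\<Prod>k=1..m. (4 * real k ^ 2) / (4 * real k ^ 2 - 1)) = 1" for m
  proof (induction m)
    case (Suc m)
    have "0 \<le> real m * 8" "0 \<le> real m * (real m * 4)" by auto
    hence nz: "3 + (real m * 8 + real m * (real m * 4)) \<noteq> 0" by linarith
    have "4 * real (Suc m) ^ 2 - 1 = (2 * m + 1) * (2 * m + 3)"
      by (simp add: power2_eq_square algebra_simps)
    \<comment> \<open>The Wallis factor of index m + 1 is 4 (m+1)^2 / ((2m+1) (2m+3)), the inverse
      of the growth of W(m)^2 (2m + 1).\<close>
    hence st: "(W (Suc m))\<^sup>2 * (2 * Suc m + 1) * ((4 * real (Suc m) ^ 2) / (4 * real (Suc m) ^ 2 - 1)) =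
        (W m)\<^sup>2 * (2 * m + 1)"
      unfolding Wsuc by (simp add: divide_simps power2_eq_square) (use nz in \<open>simp add: algebra_simps\<close>)
    have "(\<Prod>k=1..Suc m. (4 * real k ^ 2) / (4 * real k ^ 2 - 1)) =
        ((4 * real (Suc m) ^ 2) / (4 * real (Suc m) ^ 2 - 1)) * (\<Prod>k=1..m. (4 * real k ^ 2) / (4 * real k ^ 2 - 1))"
      by (rule prod.nat_ivl_Suc') simp
    hence "(W (Suc m))\<^sup>2 * (2 * Suc m + 1) * (\<Prod>k=1..Suc m. (4 * real k ^ 2) / (4 * real k ^ 2 - 1)) =
        (W (Suc m))\<^sup>2 * (2 * Suc m + 1) * ((4 * real (Suc m) ^ 2) / (4 * real (Suc m) ^ 2 - 1)) *
        (\<Prod>k=1..m. (4 * real k ^ 2) / (4 * real k ^ 2 - 1))"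
      by (simp only: mult_ac)
    also have "\<dots> = 1"
      unfolding st by (rule Suc)
    finally show ?case .
  qed (simp add: W_def)
  have eq: "(W m)\<^sup>2 * (pi * m) = pi * (m / (2 * m + 1)) / (\<Prod>k=1..m. (4 * real k ^ 2) / (4 * real k ^ 2 - 1))"
    for m
  proof -
    define p where "p = (\<Prod>k=1..m. (4 * real k ^ 2) / (4 * real k ^ 2 - 1))"
    have "(W m)\<^sup>2 * (real (2 * m + 1) * p) = 1" using W by (simp only: p_def mult.assoc)
    moreover from this have "real (2 * m + 1) * p \<noteq> 0" by force
    ultimately have "(W m)\<^sup>2 = 1 / (real (2 * m + 1) * p)"
      by (subst nonzero_eq_divide_eq)
    thus ?thesis
      unfolding p_def[symmetric] by simp
  qed
  have r: "(\<lambda>m. real m / (2 * real m + 1)) \<longlonglongrightarrow> 1 / 2"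
    by real_asymp
  have "(\<lambda>m. (W m)\<^sup>2 * (pi * m)) \<longlonglongrightarrow> pi * (1 / 2) / (pi / 2)"
    unfolding eq by (rule tendsto_divide[OF tendsto_mult[OF tendsto_const r] wallis]) simp
  hence "(\<lambda>m. sqrt ((W m)\<^sup>2 * (pi * m))) \<longlonglongrightarrow> sqrt 1"
    by (intro tendsto_real_sqrt) simp
  moreover have "sqrt ((W m)\<^sup>2 * (pi * m)) = sqrt (pi * m) * ((2 * m) choose m) / 4 ^ m" for m
    by (simp add: real_sqrt_mult W_def)
  ultimately show ?thesis by simp
qed

text \<open>A crude form of Jordan's inequality, sufficient for a majorant uniform in the modulus.
  As cos x \<ge> 0, x / 2 is at most x cos^2 (x/2); then use y cos y \<le> sin y at y = x /
  2.\<close>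

lemma sin_ge_half:
  assumes "0 \<le> x" "x \<le> pi / 2"
  shows "x / 2 \<le> sin x"
proof -
  have tan: "y * cos y \<le> sin y" if "0 \<le> y" "y \<le> pi" for y
  proof -
    have "sin 0 - 0 * cos 0 \<le> sin y - y * cos y"
    proof (rule DERIV_nonneg_imp_nondecreasing[OF that(1)])
      fix t assume "0 \<le> t" "t \<le> y"
      thus "\<exists>d. ((\<lambda>y. sin y - y * cos y) has_real_derivative d) (at t) \<and> 0 \<le> d"
        using that by (intro exI[of _ "t * sin t"]) (auto intro!: derivative_eq_intros mult_nonneg_nonneg sin_ge_zero)
    qed
    thus ?thesis by simp
  qed
  have c: "0 \<le> cos (x / 2)" "0 \<le> cos x"
    using assms by (auto intro!: cos_ge_zero)
  have "x / 2 \<le> x * (1 + cos x) / 2"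
    using assms c by (simp add: algebra_simps)
  also have "\<dots> = 2 * (x / 2 * cos (x / 2)) * cos (x / 2)"
    using cos_double_cos[of "x / 2"] by (simp add: power2_eq_square)
  also have "\<dots> \<le> 2 * sin (x / 2) * cos (x / 2)"
    using tan[of "x / 2"] assms c by (intro mult_right_mono) auto
  also have "\<dots> = sin x" using sin_double[of "x / 2"] by simp
  finally show ?thesis .
qed

section \<open>Passage to the limit in the multisection identity\<close>

context
  fixes \<tau> :: real
  assumes \<tau>: "\<tau> > 0"
begin

text \<open>An odd modulus \<open>l\<close> and an exponent \<open>m\<close> with m / l^2 tending to
  \<tau>: in this scaling both sides of \<open>sum_cos_powers\<close> have Gaussian limits.\<close>

private definition l :: "nat \<Rightarrow> nat" where "l N = 2 * N + 1"
private definition m :: "nat \<Rightarrow> nat" where "m N = nat \<lceil>\<tau> * (l N)\<^sup>2\<rceil>"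

private lemma l_pos: "real (l N) > 0"
  by (simp add: l_def)

private lemma m_lower: "\<tau> * (l N)\<^sup>2 \<le> m N"
  unfolding m_def by linarith

private lemma m_upper: "m N \<le> \<tau> * (l N)\<^sup>2 + 1"
  unfolding m_def using \<tau> by (simp add: ceiling_le_iff)

private lemma l_at_top: "filterlim (\<lambda>N. real (l N)) at_top sequentially"
  unfolding l_def by real_asymp

private lemma ratio_tendsto: "(\<lambda>N. m N / (l N)\<^sup>2) \<longlonglongrightarrow> \<tau>"
proof (rule tendsto_sandwich[OF _ _ tendsto_const])
  have "(\<lambda>N. \<tau> + 1 / (l N)\<^sup>2) \<longlonglongrightarrow> \<tau> + 0"
    unfolding l_def by (intro tendsto_intros) real_asymp
  thus "(\<lambda>N. \<tau> + 1 / (l N)\<^sup>2) \<longlonglongrightarrow> \<tau>" by simp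
  show "\<forall>\<^sub>F N in sequentially. \<tau> \<le> m N / (l N)\<^sup>2"
    using m_lower l_pos by (intro always_eventually allI) (simp add: field_simps)
  show "\<forall>\<^sub>F N in sequentially. m N / (l N)\<^sup>2 \<le> \<tau> + 1 / (l N)\<^sup>2"
    using m_upper l_pos by (intro always_eventually allI) (simp add: field_simps)
qed

private lemma m_upper': "m N \<le> (\<tau> + 1) * (l N)\<^sup>2"
proof -
  have "1 \<le> (real (l N))\<^sup>2" by (simp add: l_def)
  thus ?thesis using m_upper[of N] by (simp add: algebra_simps)
qed

private lemma m_pos: "real (m N) > 0"
  using m_lower[of N] \<tau> l_pos[of N] by (smt (verit) mult_pos_pos of_nat_0_less_iff zero_less_power of_nat_power)

private lemma m_at_top: "filterlim (\<lambda>N. real (m N)) at_top sequentially"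
proof (rule filterlim_at_top_mono)
  show "filterlim (\<lambda>N. \<tau> * (l N)\<^sup>2) at_top sequentially"
    unfolding l_def using \<tau> by real_asymp
qed (use m_lower in auto)

text \<open>\<open>b\<close> and \<open>a\<close> are the terms of the left and right side of
  \<open>sum_cos_powers\<close>, both multiplied by sqrt (pi m) / (l 4^m). With this factor the term
  of index 0 in \<open>a\<close> tends to 1.\<close>

private definition b :: "nat \<Rightarrow> int \<Rightarrow> real" where
  "b N j = (if \<bar>j\<bar> \<le> int N then sqrt (pi * m N) / l N * cos (pi * j / l N) ^ (2 * m N) else 0)"

private definition a :: "nat \<Rightarrow> int \<Rightarrow> real" where
  "a N k = sqrt (pi * m N) / 4 ^ m N * centered_binomial (m N) (k * int (l N))"

private lemma a_eq_b: "infsum (a N) UNIV = infsum (b N) UNIV"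
proof -
  have "infsum (b N) UNIV = (\<Sum>j=-int N..int N. b N j)"
    by (subst infsum_finite[symmetric])
       (auto simp del: infsum_finite intro!: infsum_cong_neutral simp: b_def)
  also have "\<dots> = (\<Sum>j=-int N..int N. sqrt (pi * m N) / (l N * 4 ^ m N) * (2 * cos (pi * j / l N)) ^ (2 * m N))"
    by (rule sum.cong) (auto simp: b_def power_mult_distrib power_mult)
  also have "\<dots> = sqrt (pi * m N) / (l N * 4 ^ m N) *
      (l N * (\<Sum>\<^sub>\<infinity>k\<in>UNIV. real (centered_binomial (m N) (k * int (l N)))))"
    unfolding sum_distrib_left[symmetric] l_def sum_cos_powers ..
  also have "\<dots> = infsum (a N) UNIV"
    unfolding a_def infsum_cmult_right' using l_pos[of N] by simp
  finally show ?thesis ..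
qed

text \<open>For fixed \<open>j\<close> the angle x = pi j / l tends to 0, while m sin^2 x and m
  tan^2 x both tend to \<tau> (pi j)^2; \<open>cos_power_bounds\<close> squeezes the power between
  them.\<close>

private lemma b_tendsto: "(\<lambda>N. b N j) \<longlonglongrightarrow> sqrt (pi * \<tau>) * exp (- (pi\<^sup>2 * \<tau> * (of_int j)\<^sup>2))"
proof -
  define x where "x N = pi * j / l N" for N
  have x0: "x \<longlonglongrightarrow> 0"
    unfolding x_def l_def by real_asymp
  have s: "(\<lambda>N. real (l N) * sin (x N)) \<longlonglongrightarrow> pi * j"
    unfolding x_def l_def by real_asymp
  have c: "(\<lambda>N. cos (x N)) \<longlonglongrightarrow> 1"
    using tendsto_cos[OF x0] by simp
  have ms: "(\<lambda>N. real (m N) * (sin (x N))\<^sup>2) \<longlonglongrightarrow> \<tau> * (pi * j)\<^sup>2"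
  proof -
    have "(\<lambda>N. m N / (l N)\<^sup>2 * (real (l N) * sin (x N))\<^sup>2) \<longlonglongrightarrow> \<tau> * (pi * j)\<^sup>2"
      by (intro tendsto_intros ratio_tendsto s)
    moreover have "m N / (l N)\<^sup>2 * (real (l N) * sin (x N))\<^sup>2 = real (m N) * (sin (x N))\<^sup>2" for N
      using l_pos[of N] by (simp add: power_mult_distrib)
    ultimately show ?thesis by simp
  qed
  have mt: "(\<lambda>N. real (m N) * (tan (x N))\<^sup>2) \<longlonglongrightarrow> \<tau> * (pi * j)\<^sup>2"
  proof -
    have "(\<lambda>N. real (m N) * (sin (x N))\<^sup>2 / (cos (x N))\<^sup>2) \<longlonglongrightarrow> \<tau> * (pi * j)\<^sup>2 / 1\<^sup>2"
      by (intro tendsto_intros ms c) simp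
    thus ?thesis by (simp add: tan_def power_divide)
  qed
  have ev: "\<forall>\<^sub>F N in sequentially. cos (x N) \<noteq> 0"
    using order_tendstoD(1)[OF c, of 0] by (auto elim: eventually_mono)
  have "(\<lambda>N. cos (x N) ^ (2 * m N)) \<longlonglongrightarrow> exp (- (\<tau> * (pi * j)\<^sup>2))"
  proof (rule tendsto_sandwich)
    show "\<forall>\<^sub>F N in sequentially. exp (- (m N * (tan (x N))\<^sup>2)) \<le> cos (x N) ^ (2 * m N)"
      using ev by eventually_elim (rule cos_power_bounds)
    show "\<forall>\<^sub>F N in sequentially. cos (x N) ^ (2 * m N) \<le> exp (- (m N * (sin (x N))\<^sup>2))"
      using ev by eventually_elim (rule cos_power_bounds)
  qed (intro tendsto_intros ms mt)+
  moreover have "(\<lambda>N. sqrt (pi * m N) / l N) \<longlonglongrightarrow> sqrt (pi * \<tau>)"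
  proof -
    have "(\<lambda>N. sqrt (pi * (m N / (l N)\<^sup>2))) \<longlonglongrightarrow> sqrt (pi * \<tau>)"
      by (intro tendsto_intros ratio_tendsto)
    thus ?thesis
      by (simp add: real_sqrt_divide)
  qed
  ultimately have "(\<lambda>N. sqrt (pi * m N) / l N * cos (x N) ^ (2 * m N)) \<longlonglongrightarrow>
      sqrt (pi * \<tau>) * exp (- (\<tau> * (pi * j)\<^sup>2))"
    by (rule tendsto_mult[rotated])
  moreover have "\<forall>\<^sub>F N in sequentially. sqrt (pi * m N) / l N * cos (x N) ^ (2 * m N) = b N j"
    using eventually_ge_at_top[of "nat \<bar>j\<bar>"] by eventually_elim (auto simp: b_def x_def)
  ultimately have "(\<lambda>N. b N j) \<longlonglongrightarrow> sqrt (pi * \<tau>) * exp (- (\<tau> * (pi * j)\<^sup>2))"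
    by (rule Lim_transform_eventually)
  thus ?thesis by (simp add: power_mult_distrib mult_ac)
qed

text \<open>Because the residues are symmetric about 0, the angle stays below pi / 2 in absolute
  value. There sin x \<ge> x / 2 gives m sin^2 x \<ge> \<tau> (pi j)^2 / 4 for every
  \<open>N\<close>.\<close>

private lemma b_bound: "norm (b N j) \<le> sqrt (pi * (\<tau> + 1)) * exp (- (\<tau> * pi\<^sup>2 / 4)) ^ nat (j\<^sup>2)"
proof (cases "\<bar>j\<bar> \<le> int N")
  case True
  define x where "x = pi * \<bar>j\<bar> / l N"
  have "2 * \<bar>j\<bar> < int (l N)" using True by (simp add: l_def)
  hence "2 * real_of_int \<bar>j\<bar> < real (l N)" by linarith
  hence "pi * (2 * real_of_int \<bar>j\<bar>) < pi * l N" by simp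
  hence x: "0 \<le> x" "x < pi / 2"
    using l_pos[of N] by (simp_all add: x_def field_simps)
  hence cx: "cos x > 0" by (intro cos_gt_zero_pi) auto
  have cos: "cos (pi * j / l N) = cos x"
    unfolding x_def by (cases "j \<ge> 0") auto
  have "\<tau> * pi\<^sup>2 / 4 * (real_of_int j)\<^sup>2 = \<tau> * (l N)\<^sup>2 * (x / 2)\<^sup>2"
    using l_pos[of N] by (simp add: x_def power_mult_distrib power_divide)
  also have "\<dots> \<le> m N * (sin x)\<^sup>2"
    using sin_ge_half[of x] x m_lower by (intro mult_mono power_mono) auto
  finally have "exp (- (m N * (sin x)\<^sup>2)) \<le> exp (- (\<tau> * pi\<^sup>2 / 4 * (real_of_int j)\<^sup>2))"
    by simp
  also have "\<dots> = exp (- (\<tau> * pi\<^sup>2 / 4)) ^ nat (j\<^sup>2)"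
    by (simp flip: exp_of_nat_mult add: mult_ac)
  finally have 1: "cos x ^ (2 * m N) \<le> exp (- (\<tau> * pi\<^sup>2 / 4)) ^ nat (j\<^sup>2)"
    using cos_power_bounds(2)[of x "m N"] cx by simp
  have "sqrt (pi * m N) / l N = sqrt (pi * m N / (l N)\<^sup>2)"
    by (simp add: real_sqrt_divide)
  also have "\<dots> \<le> sqrt (pi * (\<tau> + 1))"
    using mult_left_mono[OF m_upper'[of N], of pi] l_pos[of N] by (simp add: pos_divide_le_eq mult.assoc)
  finally have 2: "sqrt (pi * m N) / l N \<le> sqrt (pi * (\<tau> + 1))" .
  have "norm (b N j) = sqrt (pi * m N) / l N * cos x ^ (2 * m N)"
    using True cx by (simp add: b_def cos abs_mult)
  also have "\<dots> \<le> sqrt (pi * (\<tau> + 1)) * exp (- (\<tau> * pi\<^sup>2 / 4)) ^ nat (j\<^sup>2)"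
    using 1 2 cx \<tau> by (intro mult_mono) auto
  finally show ?thesis .
qed (use \<tau> in \<open>simp add: b_def\<close>)

private lemma prefactor: "(\<lambda>N. sqrt (pi * m N) * ((2 * m N) choose m N) / 4 ^ m N) \<longlonglongrightarrow> 1"
proof (rule filterlim_compose[OF central_binomial_asymptotics])
  show "filterlim m at_top sequentially"
    using m_at_top by (simp add: filterlim_sequentially_iff_filterlim_real)
qed

private lemma a_eq:
  "a N k = (if nat \<bar>k\<bar> * l N \<le> m N then
     sqrt (pi * m N) / 4 ^ m N * ((2 * m N) choose (m N + nat \<bar>k\<bar> * l N)) else 0)"
  by (simp add: a_def centered_binomial_abs abs_mult nat_mult_distrib)

text \<open>With r = |k| l, which is negligible against l^2, both r^2 / (m - r) and r^2 / (m + r)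
  tend to k^2 / \<tau>.\<close>

private lemma a_tendsto: "(\<lambda>N. a N k) \<longlonglongrightarrow> exp (- ((of_int k)\<^sup>2 / \<tau>))"
proof -
  define r where "r N = nat \<bar>k\<bar> * l N" for N
  define p where "p N = sqrt (pi * m N) * ((2 * m N) choose m N) / 4 ^ m N" for N
  have rl: "(\<lambda>N. real (r N) / (l N)\<^sup>2) \<longlonglongrightarrow> 0"
  proof -
    have "real (r N) / (l N)\<^sup>2 = \<bar>k\<bar> / l N" for N
      using l_pos[of N] by (simp add: r_def power2_eq_square)
    thus ?thesis using tendsto_divide_0[OF tendsto_const filterlim_at_top_imp_at_infinity[OF l_at_top]] by simp
  qed
  have d1: "(\<lambda>N. m N / (l N)\<^sup>2 - r N / (l N)\<^sup>2) \<longlonglongrightarrow> \<tau> - 0"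
    by (intro tendsto_intros ratio_tendsto rl)
  have d2: "(\<lambda>N. m N / (l N)\<^sup>2 + r N / (l N)\<^sup>2) \<longlonglongrightarrow> \<tau> + 0"
    by (intro tendsto_intros ratio_tendsto rl)
  have rr: "(real (r N))\<^sup>2 = (of_int k)\<^sup>2 * (l N)\<^sup>2" for N
    by (simp add: r_def power_mult_distrib)
  have "\<forall>\<^sub>F N in sequentially. 0 < m N / (l N)\<^sup>2 - r N / (l N)\<^sup>2"
    using order_tendstoD(1)[OF d1, of 0] \<tau> by simp
  hence ev: "\<forall>\<^sub>F N in sequentially. r N < m N"
    by eventually_elim (use l_pos in \<open>simp add: divide_simps split: if_splits\<close>)
  have "(\<lambda>N. a N k) \<longlonglongrightarrow> 1 * exp (- ((of_int k)\<^sup>2 / \<tau>))"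
  proof (rule tendsto_sandwich)
    show "\<forall>\<^sub>F N in sequentially. p N * exp (- ((real (r N))\<^sup>2 / (real (m N) - real (r N)))) \<le> a N k"
      using ev
    proof eventually_elim
      case (elim N)
      have "sqrt (pi * m N) / 4 ^ m N * (((2 * m N) choose m N) * exp (- ((real (r N))\<^sup>2 / (real (m N) - real (r N)))))
          \<le> sqrt (pi * m N) / 4 ^ m N * ((2 * m N) choose (m N + r N))"
        using binomial_central_lower[OF elim] by (intro mult_left_mono) auto
      thus ?case using elim by (simp add: a_eq p_def r_def)
    qed
    show "\<forall>\<^sub>F N in sequentially. a N k \<le> p N * exp (- ((real (r N))\<^sup>2 / (real (m N) + real (r N))))"
      using ev
    proof eventually_elim
      case (elim N)
      have "sqrt (pi * m N) / 4 ^ m N * ((2 * m N) choose (m N + r N)) \<le>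
          sqrt (pi * m N) / 4 ^ m N * (((2 * m N) choose m N) * exp (- ((real (r N))\<^sup>2 / (real (m N) + real (r N)))))"
        using binomial_central_upper[OF less_imp_le[OF elim]] by (intro mult_left_mono) auto
      thus ?case using elim by (simp add: a_eq p_def r_def)
    qed
    have "(\<lambda>N. (of_int k)\<^sup>2 / (m N / (l N)\<^sup>2 - r N / (l N)\<^sup>2)) \<longlonglongrightarrow> (of_int k)\<^sup>2 / \<tau>"
      using tendsto_divide[OF tendsto_const d1] \<tau> by simp
    hence "(\<lambda>N. (real (r N))\<^sup>2 / (real (m N) - real (r N))) \<longlonglongrightarrow> (of_int k)\<^sup>2 / \<tau>"
      by (simp add: rr flip: diff_divide_distrib)
    thus "(\<lambda>N. p N * exp (- ((real (r N))\<^sup>2 / (real (m N) - real (r N))))) \<longlonglongrightarrow> 1 * exp (- ((of_int k)\<^sup>2 / \<tau>))"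
      unfolding p_def by (rule tendsto_mult[OF prefactor tendsto_exp[OF tendsto_minus]])
    have "(\<lambda>N. (of_int k)\<^sup>2 / (m N / (l N)\<^sup>2 + r N / (l N)\<^sup>2)) \<longlonglongrightarrow> (of_int k)\<^sup>2 / \<tau>"
      using tendsto_divide[OF tendsto_const d2] \<tau> by simp
    hence "(\<lambda>N. (real (r N))\<^sup>2 / (real (m N) + real (r N))) \<longlonglongrightarrow> (of_int k)\<^sup>2 / \<tau>"
      by (simp add: rr flip: add_divide_distrib)
    thus "(\<lambda>N. p N * exp (- ((real (r N))\<^sup>2 / (real (m N) + real (r N))))) \<longlonglongrightarrow> 1 * exp (- ((of_int k)\<^sup>2 / \<tau>))"
      unfolding p_def by (rule tendsto_mult[OF prefactor tendsto_exp[OF tendsto_minus]])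
  qed
  thus ?thesis by simp
qed

text \<open>Nonzero terms have r = |k| l \<le> m, so r^2 / (m + r) \<ge> r^2 / (2m) \<ge> k^2 / (2
  (\<tau> + 1)). The constant \<open>K\<close> bounds the convergent prefactor.\<close>

private lemma a_bound:
  obtains K where "K > 0" "\<And>N k. norm (a N k) \<le> K * exp (- (1 / (2 * (\<tau> + 1)))) ^ nat (k\<^sup>2)"
proof -
  have "convergent (\<lambda>N. sqrt (pi * m N) * ((2 * m N) choose m N) / 4 ^ m N)"
    using prefactor convergent_def by blast
  then obtain K where K: "K > 0" "\<And>N. norm (sqrt (pi * m N) * ((2 * m N) choose m N) / 4 ^ m N) \<le> K"
    by (meson BseqE convergent_imp_Bseq)
  have "norm (a N k) \<le> K * exp (- (1 / (2 * (\<tau> + 1)))) ^ nat (k\<^sup>2)" for N k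
  proof (cases "nat \<bar>k\<bar> * l N \<le> m N")
    case True
    define r where "r = nat \<bar>k\<bar> * l N"
    have rm: "r \<le> m N" using True by (simp add: r_def)
    have rr: "(real r)\<^sup>2 = k\<^sup>2 * (l N)\<^sup>2"
      by (simp add: r_def power_mult_distrib)
    have "1 / (2 * (\<tau> + 1)) * k\<^sup>2 = (real r)\<^sup>2 / (2 * ((\<tau> + 1) * (l N)\<^sup>2))"
      using l_pos[of N] \<tau> by (simp add: rr)
    also have "\<dots> \<le> (real r)\<^sup>2 / (2 * m N)"
      using m_upper'[of N] m_pos[of N] \<tau> l_pos[of N] by (intro divide_left_mono mult_pos_pos) auto
    finally have e: "1 / (2 * (\<tau> + 1)) * k\<^sup>2 \<le> (real r)\<^sup>2 / (2 * m N)" .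
    have "((2 * m N) choose (m N + r)) \<le> ((2 * m N) choose m N) * exp (- ((real r)\<^sup>2 / (2 * m N)))"
    proof (rule order_trans[OF binomial_central_upper[OF rm]])
      have "(real r)\<^sup>2 / (2 * m N) \<le> (real r)\<^sup>2 / (real (m N) + real r)"
        using rm m_pos[of N] by (intro divide_left_mono) auto
      thus "((2 * m N) choose m N) * exp (- ((real r)\<^sup>2 / (real (m N) + real r))) \<le>
          ((2 * m N) choose m N) * exp (- ((real r)\<^sup>2 / (2 * m N)))"
        by (intro mult_left_mono) auto
    qed
    also have "\<dots> \<le> ((2 * m N) choose m N) * exp (- (1 / (2 * (\<tau> + 1)) * k\<^sup>2))"
      using e by (intro mult_left_mono) auto
    also have "exp (- (1 / (2 * (\<tau> + 1)) * k\<^sup>2)) = exp (- (1 / (2 * (\<tau> + 1)))) ^ nat (k\<^sup>2)"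
      by (simp flip: exp_of_nat_mult add: mult_ac)
    finally have "sqrt (pi * m N) / 4 ^ m N * ((2 * m N) choose (m N + r)) \<le>
        sqrt (pi * m N) / 4 ^ m N * (((2 * m N) choose m N) * exp (- (1 / (2 * (\<tau> + 1)))) ^ nat (k\<^sup>2))"
      by (intro mult_left_mono) auto
    also have "\<dots> = (sqrt (pi * m N) * ((2 * m N) choose m N) / 4 ^ m N) * exp (- (1 / (2 * (\<tau> + 1)))) ^ nat (k\<^sup>2)"
      by simp
    also have "\<dots> \<le> K * exp (- (1 / (2 * (\<tau> + 1)))) ^ nat (k\<^sup>2)"
      using K(2)[of N] by (intro mult_right_mono) auto
    finally show ?thesis
      using True by (simp add: a_eq r_def)
  qed (use K(1) in \<open>simp add: a_eq\<close>)
  with K(1) that show ?thesis by blast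
qed

text \<open>Poisson summation for the Gaussian. By dominated convergence the two sides are limits of
  sequences that coincide by \<open>a_eq_b\<close>.\<close>

theorem gaussian_sum_transformation:
  "(\<Sum>\<^sub>\<infinity>k\<in>(UNIV::int set). exp (- ((of_int k)\<^sup>2 / \<tau>))) =
    sqrt (pi * \<tau>) * (\<Sum>\<^sub>\<infinity>j\<in>(UNIV::int set). exp (- (pi\<^sup>2 * \<tau> * (of_int j)\<^sup>2)))"
proof -
  obtain K where K: "K > 0" "\<And>N k. norm (a N k) \<le> K * exp (- (1 / (2 * (\<tau> + 1)))) ^ nat (k\<^sup>2)"
    using a_bound by blast
  have sm: "(\<lambda>k::int. C * exp (- c) ^ nat (k\<^sup>2)) summable_on UNIV" if "c > 0" for c C :: real
    using that by (intro summable_on_cmult_right theta3_summable) auto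
  have "(\<lambda>N. infsum (a N) UNIV) \<longlonglongrightarrow> (\<Sum>\<^sub>\<infinity>k\<in>(UNIV::int set). exp (- ((of_int k)\<^sup>2 / \<tau>)))"
    by (rule infsum_dominated_convergence[OF a_tendsto K(2) sm]) (use \<tau> in auto)
  moreover have "(\<lambda>N. infsum (b N) UNIV) \<longlonglongrightarrow>
      (\<Sum>\<^sub>\<infinity>j\<in>(UNIV::int set). sqrt (pi * \<tau>) * exp (- (pi\<^sup>2 * \<tau> * (of_int j)\<^sup>2)))"
    by (rule infsum_dominated_convergence[OF b_tendsto b_bound sm]) (use \<tau> in auto)
  ultimately show ?thesis
    unfolding a_eq_b infsum_cmult_right' using LIMSEQ_unique by blast
qed

end

theorem theta3_inversion:
  assumes "t > 0"
  shows "theta3 (exp (- (pi / t))) = sqrt t * theta3 (exp (- (pi * t)))"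
proof -
  have e: "exp (- c) ^ nat (k\<^sup>2) = exp (- (c * (of_int k)\<^sup>2))" for c :: real and k :: int
    by (simp flip: exp_of_nat_mult add: mult_ac)
  \<comment> \<open>Choosing \<tau> = t / pi gives the exponents -pi k^2 / t and -pi t j^2 and the
    prefactor sqrt t.\<close>
  have "t / pi > 0" using assms by simp
  from gaussian_sum_transformation[OF this] show ?thesis
    using assms unfolding theta3_def e by (simp add: mult_ac power2_eq_square)
qed

section \<open>The arithmetic-geometric mean\<close>

lemma nat_sum_squares: "nat ((m::int)\<^sup>2 + n\<^sup>2) = nat (m\<^sup>2) + nat (n\<^sup>2)"
  by (simp add: nat_add_distrib)

lemma theta3_pair_summable:
  fixes q r :: "'a::{real_normed_field, banach}"
  assumes "norm q < 1" "norm r < 1"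
  shows "(\<lambda>(m::int, n::int). q ^ nat (m\<^sup>2) * r ^ nat (n\<^sup>2)) summable_on A"
proof -
  have "(\<lambda>(m::int, n::int). q ^ nat (m\<^sup>2) * r ^ nat (n\<^sup>2)) abs_summable_on UNIV \<times> UNIV"
    unfolding Infinite_Sum.abs_summable_on_Sigma_iff case_prod_conv norm_mult
    using theta3_abs_summable[OF assms(1), of UNIV] theta3_abs_summable[OF assms(2), of UNIV]
    by (auto simp: infsum_cmult_right' norm_mult abs_mult infsum_nonneg
        intro: summable_on_cmult_left summable_on_cmult_right)
  from summable_on_subset_banach[OF abs_summable_summable[OF this]] show ?thesis by simp
qed

lemma theta3_mult:
  fixes q r :: "'a::{real_normed_field, banach}"
  assumes "norm q < 1" "norm r < 1"
  shows "theta3 q * theta3 r = (\<Sum>\<^sub>\<infinity>(m, n). q ^ nat (m\<^sup>2) * r ^ nat (n\<^sup>2))"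
proof -
  have "(\<Sum>\<^sub>\<infinity>(m, n)\<in>UNIV \<times> UNIV. q ^ nat (m\<^sup>2) * r ^ nat (n\<^sup>2)) =
      (\<Sum>\<^sub>\<infinity>m\<in>UNIV. \<Sum>\<^sub>\<infinity>n\<in>UNIV. q ^ nat (m\<^sup>2) * r ^ nat (n\<^sup>2))"
    using theta3_pair_summable[OF assms, of "UNIV \<times> UNIV"] by (rule infsum_Sigma'_banach[symmetric])
  also have "\<dots> = theta3 q * theta3 r"
    unfolding theta3_def by (simp add: infsum_cmult_right' infsum_cmult_left')
  finally show ?thesis by simp
qed

lemma minus_power_square: "(- q) ^ nat (n\<^sup>2) = (if even n then 1 else - 1) * (q::'a::comm_ring_1) ^ nat (n\<^sup>2)"
proof -
  have "even (nat (n\<^sup>2)) \<longleftrightarrow> even n"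
    by (simp add: even_nat_iff)
  thus ?thesis
    by (cases "even n") auto
qed

text \<open>The rotation \<open>(a, b) \<mapsto> (a + b, a - b)\<close> maps the square lattice onto the pairs of even sum
  and doubles the norm.\<close>

lemma infsum_even_pairs:
  fixes q r :: "'a::{real_normed_field, banach}"
  assumes r: "r\<^sup>2 = 1"
  shows "(\<Sum>\<^sub>\<infinity>(m::int, n::int)\<in>{(m, n). even (m + n)}. (if even n then 1 else r) * q ^ nat (m\<^sup>2 + n\<^sup>2)) =
    (\<Sum>\<^sub>\<infinity>(m, n). (r * q\<^sup>2) ^ nat (m\<^sup>2) * (r * q\<^sup>2) ^ nat (n\<^sup>2))"
proof (rule infsum_reindex_bij_witness[of _ "\<lambda>(a, b). (a + b, a - b)"
      "\<lambda>(m, n). ((m + n) div 2, (m - n) div 2)"])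
  fix z :: "int \<times> int" assume "z \<in> {(m, n). even (m + n)}"
  then obtain m n where z: "z = (m, n)" "even (m + n)" by auto
  define a b where "a = (m + n) div 2" and "b = (m - n) div 2"
  have mn: "m = a + b" "n = a - b"
    using z(2) unfolding a_def b_def by presburger+
  have rp: "r ^ k = (if even k then 1 else r)" for k :: nat
    using r by (cases "even k") (auto elim!: evenE oddE simp: power_mult)
  have "m\<^sup>2 + n\<^sup>2 = 2 * (a\<^sup>2 + b\<^sup>2)"
    unfolding mn by algebra
  hence "nat (m\<^sup>2 + n\<^sup>2) = 2 * nat (a\<^sup>2 + b\<^sup>2)"
    by (simp add: nat_mult_distrib)
  \<comment> \<open>As n = a - b has the parity of a^2 + b^2, the sign attached to \<open>n\<close>
    is the power of \<open>r\<close> with exponent a^2 + b^2.\<close>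
  moreover have "even (nat (a\<^sup>2 + b\<^sup>2)) \<longleftrightarrow> even n"
    by (simp add: even_nat_iff mn)
  ultimately have "(r * q\<^sup>2) ^ nat (a\<^sup>2 + b\<^sup>2) = (if even n then 1 else r) * q ^ nat (m\<^sup>2 + n\<^sup>2)"
    by (simp add: power_mult_distrib rp power_mult)
  thus "(case (case z of (m, n) \<Rightarrow> ((m + n) div 2, (m - n) div 2)) of
      (m, n) \<Rightarrow> (r * q\<^sup>2) ^ nat (m\<^sup>2) * (r * q\<^sup>2) ^ nat (n\<^sup>2)) =
      (case z of (m, n) \<Rightarrow> (if even n then 1 else r) * q ^ nat (m\<^sup>2 + n\<^sup>2))"
    by (simp add: z a_def b_def nat_sum_squares power_add)
next
  fix z :: "int \<times> int" assume "z \<in> {(m, n). even (m + n)}"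
  then obtain m n where z: "z = (m, n)" "even (m + n)" by auto
  then obtain b where "m = n + 2 * b"
    by (metis add.commute diff_add_cancel even_diff evenE)
  thus "(case (case z of (m, n) \<Rightarrow> ((m + n) div 2, (m - n) div 2)) of (a, b) \<Rightarrow> (a + b, a - b)) = z"
    by (simp add: z)
next
  fix z :: "int \<times> int"
  show "(case (case z of (a, b) \<Rightarrow> (a + b, a - b)) of (m, n) \<Rightarrow> ((m + n) div 2, (m - n) div 2)) = z"
    "(case z of (a, b) \<Rightarrow> (a + b, a - b)) \<in> {(m, n). even (m + n)}"
    by (cases z, simp)+
qed simp

context
  fixes q :: "'a::{real_normed_field, banach}"
  assumes q: "norm q < 1"
begin

private abbreviation E where "E \<equiv> {(m::int, n::int). even (m + n)}"

private lemma split: "theta3 (s * q) * theta3 (t * q) =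
    (\<Sum>\<^sub>\<infinity>(m, n)\<in>E. (s * q) ^ nat (m\<^sup>2) * (t * q) ^ nat (n\<^sup>2)) +
    (\<Sum>\<^sub>\<infinity>(m, n)\<in>- E. (s * q) ^ nat (m\<^sup>2) * (t * q) ^ nat (n\<^sup>2))"
  if "norm s = 1" "norm t = 1" for s t
proof -
  have n: "norm (s * q) < 1" "norm (t * q) < 1" using that q by (simp_all add: norm_mult)
  show ?thesis
    unfolding theta3_mult[OF n]
    using infsum_Un_disjoint[OF theta3_pair_summable[OF n, of E] theta3_pair_summable[OF n, of "- E"]]
    by simp
qed

text \<open>Replacing q by -q fixes the terms with m + n even and negates the others, so the odd
  part cancels. The even part is evaluated by the rotation.\<close>

theorem theta3_sum_squares: "theta3 q ^ 2 + theta3 (- q) ^ 2 = 2 * theta3 (q\<^sup>2) ^ 2"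
proof -
  have 1: "(\<Sum>\<^sub>\<infinity>(m, n)\<in>E. (- q) ^ nat (m\<^sup>2) * (- q) ^ nat (n\<^sup>2)) =
      (\<Sum>\<^sub>\<infinity>(m, n)\<in>E. q ^ nat (m\<^sup>2) * q ^ nat (n\<^sup>2))"
    by (rule infsum_cong) (auto simp: minus_power_square mult.commute split: if_splits)
  have 2: "(\<Sum>\<^sub>\<infinity>(m, n)\<in>- E. (- q) ^ nat (m\<^sup>2) * (- q) ^ nat (n\<^sup>2)) =
      (\<Sum>\<^sub>\<infinity>(m, n)\<in>- E. - (q ^ nat (m\<^sup>2) * q ^ nat (n\<^sup>2)))"
    by (rule infsum_cong) (auto simp: minus_power_square mult.commute split: if_splits)
  have 3: "\<dots> = - (\<Sum>\<^sub>\<infinity>(m, n)\<in>- E. q ^ nat (m\<^sup>2) * q ^ nat (n\<^sup>2))"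
    by (simp add: infsum_uminus[symmetric] case_prod_unfold)
  have "norm (q\<^sup>2) < 1" using q by (simp add: norm_power power_less_one_iff)
  hence 4: "(\<Sum>\<^sub>\<infinity>(m, n)\<in>E. q ^ nat (m\<^sup>2) * q ^ nat (n\<^sup>2)) = theta3 (q\<^sup>2) ^ 2"
    using infsum_even_pairs[of 1 q] theta3_mult[of "q\<^sup>2" "q\<^sup>2"]
    by (simp add: nat_sum_squares power_add power2_eq_square[of "theta3 _"])
  show ?thesis
    using split[of 1 1] split[of "-1" "-1"] 1 2 3 4 by (simp add: power2_eq_square)
qed

text \<open>On pairs with m + n odd, exchanging m and n flips the sign (-1)^n, so this part equals
  its own negative. The even part is the rotation formula with r = -1.\<close>

theorem theta3_mult_minus: "theta3 q * theta3 (- q) = theta3 (- (q\<^sup>2)) ^ 2"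
proof -
  have 0: "(\<Sum>\<^sub>\<infinity>(m, n)\<in>- E. q ^ nat (m\<^sup>2) * (- q) ^ nat (n\<^sup>2)) = 0"
  proof -
    have "(\<Sum>\<^sub>\<infinity>(m, n)\<in>- E. q ^ nat (m\<^sup>2) * (- q) ^ nat (n\<^sup>2)) =
        (\<Sum>\<^sub>\<infinity>(m, n)\<in>- E. - (q ^ nat (m\<^sup>2) * (- q) ^ nat (n\<^sup>2)))"
      by (rule infsum_reindex_bij_witness[of _ prod.swap prod.swap]) (auto simp: minus_power_square mult.commute split: if_splits)
    also have "\<dots> = - (\<Sum>\<^sub>\<infinity>(m, n)\<in>- E. q ^ nat (m\<^sup>2) * (- q) ^ nat (n\<^sup>2))"
      by (simp add: infsum_uminus[symmetric] case_prod_unfold)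
    finally have "2 * (\<Sum>\<^sub>\<infinity>(m, n)\<in>- E. q ^ nat (m\<^sup>2) * (- q) ^ nat (n\<^sup>2)) = 0"
      unfolding eq_neg_iff_add_eq_0 mult_2 .
    thus ?thesis by simp
  qed
  have 1: "(\<Sum>\<^sub>\<infinity>(m, n)\<in>E. q ^ nat (m\<^sup>2) * (- q) ^ nat (n\<^sup>2)) =
      (\<Sum>\<^sub>\<infinity>(m, n)\<in>E. (if even n then 1 else - 1) * q ^ nat (m\<^sup>2 + n\<^sup>2))"
    by (rule infsum_cong) (auto simp: minus_power_square nat_sum_squares power_add)
  have "norm (- (q\<^sup>2)) < 1" using q by (simp add: norm_power power_less_one_iff)
  hence 2: "(\<Sum>\<^sub>\<infinity>(m, n)\<in>E. (if even n then 1 else - 1) * q ^ nat (m\<^sup>2 + n\<^sup>2)) = theta3 (- (q\<^sup>2)) ^ 2"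
    using infsum_even_pairs[of "-1" q] theta3_mult[of "- (q\<^sup>2)" "- (q\<^sup>2)"]
    by (simp add: power2_eq_square[of "theta3 _"])
  show ?thesis
    using split[of 1 "-1"] 0 1 2 by simp
qed

end

section \<open>Gauss' integral for the arithmetic-geometric mean\<close>

definition agm_integrand :: "real \<Rightarrow> real \<Rightarrow> real \<Rightarrow> real" where
  "agm_integrand a b x = 1 / sqrt ((x\<^sup>2 + a\<^sup>2) * (x\<^sup>2 + b\<^sup>2))"

text \<open>For positive arguments this is pi divided by their arithmetic-geometric mean. The
  substitution x = b tan y leads to the trigonometric form with integrand 1 / sqrt (a^2 cos^2 y +
  b^2 sin^2 y).\<close>

definition agm_integral :: "real \<Rightarrow> real \<Rightarrow> real" where
  "agm_integral a b = integral UNIV (agm_integrand a b)"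

lemma agm_integrand_nonneg: "0 \<le> agm_integrand a b x"
  by (simp add: agm_integrand_def)

lemma agm_integrand_mono:
  assumes "0 < a'" "a' \<le> a" "0 < b'" "b' \<le> b"
  shows "agm_integrand a b x \<le> agm_integrand a' b' x"
  unfolding agm_integrand_def using assms
  by (intro divide_left_mono real_sqrt_le_mono mult_mono add_left_mono power_mono mult_pos_pos)
     (auto intro!: add_nonneg_pos mult_pos_pos)

text \<open>Under x -> c tan x the integral becomes that of the constant 1 / c over an interval of
  length pi.\<close>

lemma agm_integrand_diagonal:
  assumes "c > 0"
  shows "agm_integrand c c absolutely_integrable_on UNIV" "agm_integral c c = pi / c"
proof -
  define S where "S = {- (pi / 2)<..<pi / 2}"
  have cos: "cos x > 0" if "x \<in> S" for x
    using that by (auto simp: S_def intro: cos_gt_zero_pi)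
  have int: "\<bar>c * inverse ((cos x)\<^sup>2)\<bar> * agm_integrand c c (c * tan x) = 1 / c" if "x \<in> S" for x
  proof -
    have "(c * tan x)\<^sup>2 + c\<^sup>2 = c\<^sup>2 * (1 + (tan x)\<^sup>2)"
      by (simp add: power_mult_distrib algebra_simps)
    also have "1 + (tan x)\<^sup>2 = inverse ((cos x)\<^sup>2)"
      using tan_sec[of x] cos[OF that] by (simp add: power_inverse)
    finally have "agm_integrand c c (c * tan x) = 1 / (c\<^sup>2 * inverse ((cos x)\<^sup>2))"
      by (simp add: agm_integrand_def)
    thus ?thesis
      using assms cos[OF that] by (simp add: power2_eq_square)
  qed
  have img: "(\<lambda>x. c * tan x) ` S = UNIV"
  proof -
    have "y \<in> (\<lambda>x. c * tan x) ` S" for y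
      by (rule image_eqI[of _ _ "arctan (y / c)"])
         (use assms arctan_lbound arctan_ubound in \<open>auto simp: S_def tan_arctan\<close>)
    thus ?thesis by blast
  qed
  have inj: "inj_on (\<lambda>x. c * tan x) S"
  proof (rule inj_onI)
    fix x y assume xy: "x \<in> S" "y \<in> S" "c * tan x = c * tan y"
    have "arctan (tan z) = z" if "z \<in> S" for z
      using that by (intro arctan_tan) (auto simp: S_def)
    moreover have "tan x = tan y" using xy(3) assms by simp
    ultimately show "x = y" using xy by metis
  qed
  have der: "((\<lambda>x. c * tan x) has_field_derivative c * inverse ((cos x)\<^sup>2)) (at x within S)" if "x \<in> S" for x
    using cos[OF that] by (intro DERIV_cmult DERIV_subset[OF DERIV_tan]) auto
  have "((\<lambda>_. 1 / c) has_integral pi / c) S"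
    using has_integral_const_real[of "1 / c" "- (pi / 2)" "pi / 2"]
    unfolding S_def has_integral_Icc_iff_Ioo by simp
  hence "((\<lambda>x. \<bar>c * inverse ((cos x)\<^sup>2)\<bar> * agm_integrand c c (c * tan x)) has_integral pi / c) S"
    by (rule has_integral_eq[rotated]) (simp only: int)
  hence "(\<lambda>x. \<bar>c * inverse ((cos x)\<^sup>2)\<bar> * agm_integrand c c (c * tan x)) absolutely_integrable_on S \<and>
      integral S (\<lambda>x. \<bar>c * inverse ((cos x)\<^sup>2)\<bar> * agm_integrand c c (c * tan x)) = pi / c"
    by (auto intro!: nonnegative_absolutely_integrable_1 mult_nonneg_nonneg agm_integrand_nonneg dest: has_integral_integrable integral_unique)
  moreover have "S \<in> sets lebesgue" by (simp add: S_def)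
  ultimately have "agm_integrand c c absolutely_integrable_on UNIV \<and> integral UNIV (agm_integrand c c) = pi / c"
    using has_absolute_integral_change_of_variables_1'[OF _ der inj, of "agm_integrand c c" "pi / c"]
    by (simp add: img)
  thus "agm_integrand c c absolutely_integrable_on UNIV" "agm_integral c c = pi / c"
    by (simp_all add: agm_integral_def)
qed

lemma agm_integrable:
  assumes "0 < a" "0 < b"
  shows "agm_integrand a b absolutely_integrable_on UNIV"
proof (rule measurable_bounded_by_integrable_imp_absolutely_integrable)
  have p: "0 < x\<^sup>2 + c\<^sup>2" if "c > 0" for x c :: real
    using that by (intro add_nonneg_pos) auto
  have "continuous_on UNIV (agm_integrand a b)"
    unfolding agm_integrand_def[abs_def] using assms p[of a] p[of b]
    by (intro continuous_intros) (auto simp: less_imp_neq[symmetric])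
  thus "agm_integrand a b \<in> borel_measurable (lebesgue_on UNIV)"
    by (rule continuous_imp_measurable_on_sets_lebesgue) auto
  have "min a b > 0" using assms by simp
  thus "agm_integrand (min a b) (min a b) integrable_on UNIV"
    using agm_integrand_diagonal(1) set_lebesgue_integral_eq_integral(1) by blast
  show "norm (agm_integrand a b x) \<le> agm_integrand (min a b) (min a b) x" for x
    using agm_integrand_mono[of "min a b" a "min a b" b x] assms agm_integrand_nonneg by simp
qed auto

lemma agm_integral_mono:
  assumes "0 < a'" "a' \<le> a" "0 < b'" "b' \<le> b"
  shows "agm_integral a b \<le> agm_integral a' b'"
  unfolding agm_integral_def
  by (intro integral_le set_lebesgue_integral_eq_integral(1) agm_integrable agm_integrand_mono)
     (use assms in auto)

text \<open>Comparison with the two diagonal cases; along the mean iteration these bounds close up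
  and determine the invariant integral.\<close>

lemma agm_integral_bounds:
  assumes "0 < b" "b \<le> a"
  shows "pi / a \<le> agm_integral a b" "agm_integral a b \<le> pi / b"
  using agm_integral_mono[of a a b a] agm_integral_mono[of b a b b] agm_integrand_diagonal(2)[of a]
    agm_integrand_diagonal(2)[of b] assms by simp_all

lemma agm_integral_half_line:
  assumes "0 < a" "0 < b"
  shows "agm_integrand a b absolutely_integrable_on {0<..}"
    "agm_integral a b = 2 * integral {0<..} (agm_integrand a b)"
proof -
  have ai: "agm_integrand a b absolutely_integrable_on S" if "S \<in> sets lebesgue" for S
    using agm_integrable[OF assms] that set_integrable_subset by blast
  thus pos: "agm_integrand a b absolutely_integrable_on {0<..}" by simp
  have "(\<lambda>x. agm_integrand a b (- x)) absolutely_integrable_on {0<..} \<and>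
      integral {0<..} (\<lambda>x. agm_integrand a b (- x)) = integral {0<..} (agm_integrand a b)"
  proof -
    have "(\<lambda>x. agm_integrand a b (- x)) = agm_integrand a b"
      by (simp add: agm_integrand_def fun_eq_iff)
    thus ?thesis using pos by simp
  qed
  hence neg: "integral {..<0} (agm_integrand a b) = integral {0<..} (agm_integrand a b)"
    by (subst (asm) has_absolute_integral_reflect_real[of _ "{..<0}"]) auto
  have "agm_integral a b = integral ({..<0} \<union> {0<..}) (agm_integrand a b)"
    unfolding agm_integral_def
    by (rule integral_spike_set; rule negligible_subset[of "{0}"]) auto
  also have "\<dots> = integral {..<0} (agm_integrand a b) + integral {0<..} (agm_integrand a b)"
  proof -
    have "{..<0::real} \<inter> {0<..} = {}" by auto
    thus ?thesis
      by (intro integral_Un set_lebesgue_integral_eq_integral(1) ai) auto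
  qed
  finally show "agm_integral a b = 2 * integral {0<..} (agm_integrand a b)"
    using neg by simp
qed

text \<open>Landen's transformation, in Newman's form \<open>x \<mapsto> (x - a b / x) / 2\<close>.\<close>

theorem agm_integral_step:
  assumes ab: "0 < a" "0 < b"
  shows "agm_integral ((a + b) / 2) (sqrt (a * b)) = agm_integral a b"
proof -
  define g where "g x = (x - a * b / x) / 2" for x :: real
  define g' where "g' x = (x + a * b / x) / (2 * x)" for x :: real
  define f where "f = agm_integrand ((a + b) / 2) (sqrt (a * b))"
  have der: "(g has_field_derivative g' x) (at x within {0<..})" if "x \<in> {0<..}" for x
    unfolding g_def g'_def using that
    by (auto intro!: derivative_eq_intros simp: field_simps power2_eq_square)
  have inj: "inj_on g {0<..}"
  proof (rule inj_onI)
    fix x y assume xy: "x \<in> {0<..}" "y \<in> {0<..}" "g x = g y"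
    hence "(x - y) * (x * y + a * b) = 0"
      by (simp add: g_def field_simps)
    moreover have "x * y + a * b > 0"
      using xy ab by (simp add: add_pos_pos)
    ultimately show "x = y" by simp
  qed
  have img: "g ` {0<..} = UNIV"
  proof -
    have "u \<in> g ` {0<..}" for u
    proof (rule image_eqI)
      \<comment> \<open>The positive root of x^2 - 2 u x - a b = 0, which is \<open>g x = u\<close>
        cleared of denominators.\<close>
      define x where "x = u + sqrt (u\<^sup>2 + a * b)"
      have "\<bar>u\<bar> < sqrt (u\<^sup>2 + a * b)"
        using ab by (intro real_less_rsqrt) simp
      thus x: "x \<in> {0<..}" by (simp add: x_def)
      have "(x - u)\<^sup>2 = u\<^sup>2 + a * b"
        using ab by (simp add: x_def)
      thus "u = g x"
        using x by (simp add: g_def field_simps power2_eq_square)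
    qed
    thus ?thesis by blast
  qed
  have key: "\<bar>g' x\<bar> * f (g x) = 2 * agm_integrand a b x" if "x \<in> {0<..}" for x
  proof -
    \<comment> \<open>The first factor under the new root is (x^2 + a^2) (x^2 + b^2) / (4 x^2), the
      second is (x + a b / x)^2 / 4. Hence the new root is the old one times \<open>v\<close>, and
      \<open>g' x\<close> is twice \<open>v\<close>.\<close>
    define v where "v = (x + a * b / x) / (4 * x)"
    have x: "x > 0" and v: "v > 0"
      using that ab by (auto simp: v_def intro!: divide_pos_pos add_pos_pos mult_pos_pos)
    have "((g x)\<^sup>2 + ((a + b) / 2)\<^sup>2) * ((g x)\<^sup>2 + a * b) = ((x\<^sup>2 + a\<^sup>2) * (x\<^sup>2 + b\<^sup>2)) * v\<^sup>2"
      using x by (simp add: g_def v_def field_simps power2_eq_square)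
    hence "sqrt (((g x)\<^sup>2 + ((a + b) / 2)\<^sup>2) * ((g x)\<^sup>2 + a * b)) = sqrt ((x\<^sup>2 + a\<^sup>2) * (x\<^sup>2 + b\<^sup>2)) * v"
      using v by (simp add: real_sqrt_mult)
    hence "f (g x) = agm_integrand a b x / v"
      using ab by (simp add: f_def agm_integrand_def)
    moreover have "g' x = 2 * v"
      using x by (simp add: g'_def v_def field_simps)
    ultimately show ?thesis using v by (simp add: abs_mult)
  qed
  have "(\<lambda>x. 2 * agm_integrand a b x) absolutely_integrable_on {0<..}"
    using agm_integral_half_line(1)[OF ab] by (rule set_integrable_mult_right[rotated])
  hence "(\<lambda>x. \<bar>g' x\<bar> * f (g x)) absolutely_integrable_on {0<..}"
    by (rule absolutely_integrable_spike[OF _ negligible_empty]) (use key in auto)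
  moreover have "integral {0<..} (\<lambda>x. \<bar>g' x\<bar> * f (g x)) = agm_integral a b"
    unfolding agm_integral_half_line(2)[OF ab] integral_mult_right[symmetric]
    by (rule integral_cong) (use key in auto)
  ultimately have "integral UNIV f = agm_integral a b"
    using has_absolute_integral_change_of_variables_1'[OF _ der inj, of f "agm_integral a b"]
    by (simp add: img)
  thus ?thesis
    by (simp add: f_def agm_integral_def)
qed

text \<open>The substitution \<open>w = (c\<^sup>2 / (x\<^sup>2 + c\<^sup>2))\<^sup>2\<close> turns the lemniscatic case into a Beta integral.\<close>

theorem agm_integral_lemniscatic:
  assumes c: "c > 0"
  shows "agm_integral (sqrt 2 * c) c = Beta (1 / 4) (1 / 2) / (2 * c)"
proof -
  define g where "g x = (c\<^sup>2 / (x\<^sup>2 + c\<^sup>2))\<^sup>2" for x :: real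
  define g' where "g' x = - (4 * x * c ^ 4 / (x\<^sup>2 + c\<^sup>2) ^ 3)" for x :: real
  define f where "f t = t powr (1 / 4 - 1) * (1 - t) powr (1 / 2 - 1)" for t :: real
  have p: "0 < x\<^sup>2 + c\<^sup>2" for x
    using c by (intro add_nonneg_pos) auto
  have der: "(g has_field_derivative g' x) (at x within {0<..})" if "x \<in> {0<..}" for x
  proof -
    have "(g has_field_derivative 2 * (c\<^sup>2 / (x\<^sup>2 + c\<^sup>2)) * (- (c\<^sup>2 * (2 * x)) / (x\<^sup>2 + c\<^sup>2)\<^sup>2)) (at x within {0<..})"
      unfolding g_def using p[of x] by (auto intro!: derivative_eq_intros simp: power2_eq_square)
    also have "2 * (c\<^sup>2 / (x\<^sup>2 + c\<^sup>2)) * (- (c\<^sup>2 * (2 * x)) / (x\<^sup>2 + c\<^sup>2)\<^sup>2) = g' x"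
      unfolding g'_def by (simp add: power2_eq_square power3_eq_cube power4_eq_xxxx mult_ac)
    finally show ?thesis .
  qed
  have inj: "inj_on g {0<..}"
  proof (rule inj_onI)
    fix x y assume xy: "x \<in> {0<..}" "y \<in> {0<..}" "g x = g y"
    hence "c\<^sup>2 / (x\<^sup>2 + c\<^sup>2) = c\<^sup>2 / (y\<^sup>2 + c\<^sup>2)"
      unfolding g_def using p by (subst (asm) power2_eq_iff_nonneg) (auto simp: less_imp_le)
    hence "x\<^sup>2 = y\<^sup>2"
      using p[of x] p[of y] c by (simp add: field_simps)
    thus "x = y" using xy by (simp add: power2_eq_iff_nonneg)
  qed
  have img: "g ` {0<..} = {0<..<1}"
  proof (intro equalityI subsetI)
    fix t assume "t \<in> g ` {0<..}"
    then obtain x where x: "x > 0" "t = g x" by auto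
    have "0 < c\<^sup>2 / (x\<^sup>2 + c\<^sup>2)" "c\<^sup>2 / (x\<^sup>2 + c\<^sup>2) < 1"
      using c x p[of x] by auto
    thus "t \<in> {0<..<1}"
      unfolding x g_def using c x(1) by (simp add: power_less_one_iff)
  next
    fix t :: real assume t: "t \<in> {0<..<1}"
    \<comment> \<open>Solves c^2 / (x^2 + c^2) = sqrt t.\<close>
    define x where "x = c * sqrt (1 / sqrt t - 1)"
    have s: "0 < sqrt t" "sqrt t < 1" using t by auto
    hence "1 / sqrt t - 1 > 0" by (simp add: field_simps)
    hence "x > 0" "x\<^sup>2 = c\<^sup>2 * (1 / sqrt t - 1)"
      using c by (simp_all add: x_def power_mult_distrib)
    moreover from this(2) have "x\<^sup>2 + c\<^sup>2 = c\<^sup>2 / sqrt t"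
      by (simp add: algebra_simps)
    hence "g x = t"
      using t c by (simp add: g_def)
    ultimately show "t \<in> g ` {0<..}" by auto
  qed
  have key: "\<bar>g' x\<bar> * f (g x) = 4 * c * agm_integrand (sqrt 2 * c) c x" if "x \<in> {0<..}" for x
  proof -
    \<comment> \<open>In these variables g x = (c / u)^4 and 1 - g x = (x v / u^2)^2, so the Beta
      exponents -3/4 and -1/2 yield rational expressions in x, u and v.\<close>
    define u v where "u = sqrt (x\<^sup>2 + c\<^sup>2)" and "v = sqrt (x\<^sup>2 + 2 * c\<^sup>2)"
    have x: "x > 0" using that by simp
    have v2: "0 < x\<^sup>2 + 2 * c\<^sup>2" using c by (intro add_nonneg_pos) auto
    have u: "u > 0" "u\<^sup>2 = x\<^sup>2 + c\<^sup>2" and v: "v > 0" "v\<^sup>2 = x\<^sup>2 + 2 * c\<^sup>2"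
      using p[of x] v2 by (simp_all add: u_def v_def)
    have gx: "g x = (c / u) ^ 4"
      unfolding g_def u(2)[symmetric] by (simp add: power_divide flip: power_mult)
    have "g x powr (1 / 4 - 1) = ((c / u) powr 4) powr (1 / 4 - 1)"
      unfolding gx using c u by (simp add: powr_numeral)
    also have "\<dots> = (c / u) powr (- 3)"
      by (simp add: powr_powr)
    also have "\<dots> = (u / c) ^ 3"
      using c u by (simp add: powr_minus powr_numeral power_divide)
    finally have g1: "g x powr (1 / 4 - 1) = (u / c) ^ 3" .
    have "u ^ 4 - c ^ 4 = x\<^sup>2 * v\<^sup>2"
      using u(2) v(2) by algebra
    moreover have "1 - (c / u) ^ 4 = (u ^ 4 - c ^ 4) / u ^ 4"
      using u(1) by (simp add: power_divide diff_divide_distrib)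
    ultimately have "1 - g x = (x * v / u\<^sup>2)\<^sup>2"
      unfolding gx by (simp add: power_divide power_mult_distrib flip: power_mult)
    hence "(1 - g x) powr (1 / 2 - 1) = ((x * v / u\<^sup>2) powr 2) powr (- (1 / 2))"
      using x u v by (simp add: powr_numeral)
    also have "\<dots> = (x * v / u\<^sup>2) powr (- 1)"
      by (simp add: powr_powr)
    also have "\<dots> = u\<^sup>2 / (x * v)"
      using x u v by (simp add: powr_minus)
    finally have g2: "(1 - g x) powr (1 / 2 - 1) = u\<^sup>2 / (x * v)" .
    have "(x\<^sup>2 + c\<^sup>2) ^ 3 = u ^ 6"
      unfolding u(2)[symmetric] power_mult[symmetric] by simp
    hence g'_abs: "\<bar>g' x\<bar> = 4 * x * c ^ 4 / u ^ 6"
      unfolding g'_def using x c u by (simp add: abs_mult)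
    have "\<bar>g' x\<bar> * f (g x) = 4 * c / (v * u)"
      unfolding f_def g1 g2 g'_abs using x c u(1) v(1) by (simp add: field_simps eval_nat_numeral)
    moreover have "agm_integrand (sqrt 2 * c) c x = 1 / (v * u)"
      unfolding agm_integrand_def u_def v_def by (simp add: real_sqrt_mult power_mult_distrib)
    ultimately show ?thesis by simp
  qed
  have s: "0 < sqrt 2 * c" using c by simp
  have "(\<lambda>x. 4 * c * agm_integrand (sqrt 2 * c) c x) absolutely_integrable_on {0<..}"
    using agm_integral_half_line(1)[OF s c] by (rule set_integrable_mult_right[rotated])
  hence "(\<lambda>x. \<bar>g' x\<bar> * f (g x)) absolutely_integrable_on {0<..}"
    by (rule absolutely_integrable_spike[OF _ negligible_empty]) (use key in auto)
  moreover have "integral {0<..} (\<lambda>x. \<bar>g' x\<bar> * f (g x)) = 2 * c * agm_integral (sqrt 2 * c) c"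
  proof -
    have "integral {0<..} (\<lambda>x. \<bar>g' x\<bar> * f (g x)) = integral {0<..} (\<lambda>x. 4 * c * agm_integrand (sqrt 2 * c) c x)"
      by (rule integral_cong) (use key in auto)
    thus ?thesis
      by (simp add: agm_integral_half_line(2)[OF s c])
  qed
  ultimately have "integral {0<..<1} f = 2 * c * agm_integral (sqrt 2 * c) c"
    using has_absolute_integral_change_of_variables_1'[OF _ der inj, of f "2 * c * agm_integral (sqrt 2 * c) c"]
    by (simp add: img)
  moreover have "(f has_integral Beta (1 / 4) (1 / 2)) {0<..<1}"
    using has_integral_Beta_real[of "1 / 4" "1 / 2"]
    unfolding f_def[abs_def] has_integral_Icc_iff_Ioo by simp
  ultimately have "Beta (1 / 4) (1 / 2) = 2 * c * agm_integral (sqrt 2 * c) c"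
    by (simp add: integral_unique)
  thus ?thesis using c by simp
qed

section \<open>Evaluation\<close>

lemma theta3_0: "theta3 (0::'a::{real_normed_field, banach}) = 1"
proof -
  have "theta3 (0::'a) = (\<Sum>\<^sub>\<infinity>n\<in>{0::int}. 0 ^ nat (n\<^sup>2))"
    unfolding theta3_def by (rule infsum_cong_neutral) auto
  thus ?thesis by simp
qed

lemma theta3_tendsto_1:
  fixes r :: "nat \<Rightarrow> real"
  assumes "r \<longlonglongrightarrow> 0" and "\<And>n. \<bar>r n\<bar> \<le> q" and "q < 1"
  shows "(\<lambda>n. theta3 (r n)) \<longlonglongrightarrow> 1"
proof -
  have q: "0 \<le> q" using assms(2)[of 0] by linarith
  have "(\<lambda>n. theta3 (r n)) \<longlonglongrightarrow> theta3 0"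
    unfolding theta3_def
  proof (rule infsum_dominated_convergence)
    show "(\<lambda>n. r n ^ nat (x\<^sup>2)) \<longlonglongrightarrow> 0 ^ nat (x\<^sup>2)" for x :: int
      by (intro tendsto_intros assms)
    show "norm (r n ^ nat (x\<^sup>2)) \<le> q ^ nat (x\<^sup>2)" for n and x :: int
      using assms(2) by (simp add: power_abs power_mono)
    show "(\<lambda>x::int. q ^ nat (x\<^sup>2)) summable_on UNIV"
      using q assms(3) by (intro theta3_summable) simp
  qed
  thus ?thesis by (simp add: theta3_0)
qed

lemma abs_theta3_minus_le:
  fixes q :: real
  assumes "0 \<le> q" "q < 1"
  shows "\<bar>theta3 (- q)\<bar> \<le> theta3 q"
proof -
  have "norm (theta3 (- q)) \<le> (\<Sum>\<^sub>\<infinity>n\<in>(UNIV::int set). norm ((- q) ^ nat (n\<^sup>2)))"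
    unfolding theta3_def using assms by (intro norm_infsum_bound theta3_abs_summable) simp
  thus ?thesis
    using assms by (simp add: theta3_def norm_power)
qed

text \<open>The squares of \<open>theta3 (q ^ 2 ^ n)\<close> and \<open>theta3 (- q ^ 2 ^ n)\<close> run through the
  arithmetic-geometric mean iteration and converge to 1, while the integral is invariant.\<close>

theorem agm_integral_theta3:
  fixes q :: real
  assumes q: "0 < q" "q < 1"
  shows "agm_integral ((theta3 q)\<^sup>2) ((theta3 (- q))\<^sup>2) = pi"
proof -
  define r where "r n = q ^ (2 ^ n)" for n :: nat
  define a where "a n = (theta3 (r n))\<^sup>2" for n
  define b where "b n = (theta3 (- r n))\<^sup>2" for n
  have r: "0 < r n" "r n < 1" "r n \<le> q" for n
    using q power_decreasing[of 1 "2 ^ n" q] by (simp_all add: r_def power_less_one_iff)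
  have r_Suc: "r (Suc n) = (r n)\<^sup>2" for n
    by (simp add: r_def power_mult[symmetric] mult.commute)
  have "r \<longlonglongrightarrow> 0"
  proof (rule tendsto_sandwich[OF _ _ tendsto_const])
    show "\<forall>\<^sub>F n in sequentially. r n \<le> q ^ n"
      using q by (auto simp: r_def less_imp_le[OF less_exp] intro!: power_decreasing)
    show "(\<lambda>n. q ^ n) \<longlonglongrightarrow> 0"
      using q by (intro LIMSEQ_power_zero) simp
  qed (use r in \<open>auto simp: less_imp_le\<close>)
  from this tendsto_minus[OF this]
  have "(\<lambda>n. theta3 (r n)) \<longlonglongrightarrow> 1" "(\<lambda>n. theta3 (- r n)) \<longlonglongrightarrow> 1"
    using r q by (auto intro!: theta3_tendsto_1[of _ q] simp: less_imp_le)
  hence lim: "a \<longlonglongrightarrow> 1" "b \<longlonglongrightarrow> 1"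
    unfolding a_def b_def using tendsto_power[of _ 1 _ 2] by fastforce+
  have a_pos: "a n > 0" for n
    using theta3_pos[of "r n"] r[of n] by (simp add: a_def)
  have le: "b n \<le> a n" for n
    using abs_theta3_minus_le[of "r n"] r[of n] theta3_pos[of "r n"]
    by (simp add: a_def b_def abs_le_square_iff[symmetric])
  have a_Suc: "a (Suc n) = (a n + b n) / 2" for n
    using theta3_sum_squares[of "r n"] r[of n] by (simp add: a_def b_def r_Suc)
  have b_Suc: "b (Suc n) = sqrt (a n * b n)" for n
  proof -
    have "b (Suc n) = theta3 (r n) * theta3 (- r n)"
      using theta3_mult_minus[of "r n"] r[of n] by (simp add: b_def r_Suc)
    \<comment> \<open>Being a square, \<open>b (Suc n)\<close> fixes the sign of the product, so it
      is the nonnegative geometric mean.\<close>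
    moreover have "b (Suc n) \<ge> 0" by (simp add: b_def)
    ultimately have "b (Suc n) = \<bar>theta3 (r n) * theta3 (- r n)\<bar>" by simp
    also have "\<dots> = sqrt (a n * b n)"
      by (simp add: a_def b_def flip: power_mult_distrib)
    finally show ?thesis .
  qed
  \<comment> \<open>The alternating series does not show that theta3 (-r) is nonzero. A zero of
    \<open>b\<close> would persist under geometric means, contradicting the limit 1.\<close>
  have b_pos: "b n > 0" for n
  proof (rule ccontr)
    assume "\<not> b n > 0"
    hence "b n = 0" by (simp add: b_def)
    hence "b (n + k) = 0" for k
      by (induction k) (simp_all add: b_Suc)
    hence "(\<lambda>k. b (k + n)) \<longlonglongrightarrow> 0"
      by (simp add: add.commute)
    with LIMSEQ_ignore_initial_segment[OF lim(2), of n] show False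
      using LIMSEQ_unique by fastforce
  qed
  define J where "J = agm_integral (a 0) (b 0)"
  have inv: "agm_integral (a n) (b n) = J" for n
    by (induction n) (simp_all add: J_def a_Suc b_Suc agm_integral_step a_pos b_pos)
  \<comment> \<open>J lies between pi / a(n) and pi / b(n) for every n, and both tend to pi.\<close>
  have "pi / 1 \<le> J"
    by (rule tendsto_upperbound[OF tendsto_divide[OF tendsto_const lim(1)]])
       (use agm_integral_bounds(1)[OF b_pos le] in \<open>simp_all add: inv\<close>)
  moreover have "J \<le> pi / 1"
    by (rule tendsto_lowerbound[OF tendsto_divide[OF tendsto_const lim(2)]])
       (use agm_integral_bounds(2)[OF b_pos le] in \<open>simp_all add: inv\<close>)
  ultimately show ?thesis
    by (simp add: J_def a_def b_def r_def)
qed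

text \<open>Inversion at t = 2 gives A^2 = 2 E^2 = C^2 + D^2. Hence B^2 = 2 C^2 - A^2 = C^2 - D^2,
  and A^2 B^2 = D^4 becomes C^4 - D^4 = D^4.\<close>

lemma theta3_lemniscatic_ratio: "theta3 (exp (- pi)) ^ 4 = 2 * theta3 (- exp (- pi)) ^ 4"
proof -
  define q where "q = exp (- (pi / 2))"
  define A B C D E where "A = theta3 q" and "B = theta3 (- q)" and "C = theta3 (exp (- pi))"
    and "D = theta3 (- exp (- pi))" and "E = theta3 (exp (- (pi * 2)))"
  have q: "norm q < 1" "norm (exp (- pi)) < 1" by (simp_all add: q_def)
  have sq: "q\<^sup>2 = exp (- pi)" "(exp (- pi))\<^sup>2 = exp (- (pi * 2))"
    by (simp_all add: q_def power2_eq_square flip: exp_add)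
  have 1: "A\<^sup>2 + B\<^sup>2 = 2 * C\<^sup>2" "A * B = D\<^sup>2" "C\<^sup>2 + D\<^sup>2 = 2 * E\<^sup>2"
    using theta3_sum_squares[OF q(1)] theta3_mult_minus[OF q(1)] theta3_sum_squares[OF q(2)]
    by (simp_all add: A_def B_def C_def D_def E_def sq)
  have "A = sqrt 2 * E"
    using theta3_inversion[of 2] by (simp add: A_def E_def q_def)
  hence "A\<^sup>2 = 2 * E\<^sup>2" by (simp add: power_mult_distrib)
  with 1 have "C ^ 4 = 2 * D ^ 4" by algebra
  thus ?thesis by (simp add: C_def D_def)
qed

lemma Gamma_quarter: "Gamma (1 / 4 :: real) * Gamma (3 / 4) = pi * sqrt 2"
proof -
  have "complex_of_real (Gamma (1 / 4) * Gamma (3 / 4)) = Gamma (complex_of_real (1 / 4)) * Gamma (complex_of_real (3 / 4))"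
    by (simp only: of_real_mult Gamma_complex_of_real)
  also have "\<dots> = of_real pi / sin (of_real pi * complex_of_real (1 / 4))"
    using Gamma_reflection_complex[of "complex_of_real (1 / 4)"] by (simp flip: of_real_diff)
  also have "of_real pi * complex_of_real (1 / 4) = complex_of_real (pi / 4)"
    by simp
  also have "of_real pi / sin (complex_of_real (pi / 4)) = complex_of_real (pi / sin (pi / 4))"
    unfolding sin_of_real of_real_divide[of pi "sin (pi / 4)"] ..
  finally have "Gamma (1 / 4 :: real) * Gamma (3 / 4) = pi / sin (pi / 4)"
    by (simp only: of_real_eq_iff)
  also have "\<dots> = pi * sqrt 2"
    by (simp add: sin_45 field_simps)
  finally show ?thesis .
qed

text \<open>Since C^2 = sqrt 2 D^2, the integral with value pi is the lemniscatic one with c = D^2,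
  so Beta(1/4, 1/2) = 2 pi D^2. The reflection formula then trades Gamma(1/4) for
  Gamma(3/4).\<close>

theorem theta3_exp_minus_pi: "theta3 (exp (- pi)) = pi powr (1 / 4) / Gamma (3 / 4)"
proof -
  define C D where "C = theta3 (exp (- pi))" and "D = theta3 (- exp (- pi))"
  have C: "C > 0" unfolding C_def by (rule theta3_pos) auto
  have CD: "C ^ 4 = 2 * D ^ 4"
    unfolding C_def D_def by (rule theta3_lemniscatic_ratio)
  hence D: "D\<^sup>2 > 0" using C by auto
  have "(sqrt 2 * D\<^sup>2)\<^sup>2 = (C\<^sup>2)\<^sup>2"
    using CD by (simp add: power_mult_distrib flip: power_mult)
  hence CD': "C\<^sup>2 = sqrt 2 * D\<^sup>2"
    using D by (subst (asm) power2_eq_iff_nonneg) auto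
  have "agm_integral (C\<^sup>2) (D\<^sup>2) = pi"
    unfolding C_def D_def by (rule agm_integral_theta3) auto
  hence "pi = Beta (1 / 4) (1 / 2) / (2 * D\<^sup>2)"
    unfolding CD' agm_integral_lemniscatic[OF D] ..
  hence 1: "Beta (1 / 4) (1 / 2) = 2 * D\<^sup>2 * pi"
    using D by (simp add: field_simps)
  define G where "G = Gamma (3 / 4 :: real)"
  have G: "G > 0" unfolding G_def by (rule Gamma_real_pos) simp
  have "Beta (1 / 4) (1 / 2) = Gamma (1 / 4) * sqrt pi / G"
    by (simp add: Beta_def G_def Gamma_one_half_real)
  also have "Gamma (1 / 4 :: real) = pi * sqrt 2 / G"
    using Gamma_quarter G unfolding G_def by (subst nonzero_eq_divide_eq) auto
  finally have "2 * D\<^sup>2 * pi = pi * sqrt 2 / G * sqrt pi / G"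
    using 1 by simp
  hence "2 * D\<^sup>2 = sqrt 2 * sqrt pi / G\<^sup>2"
    using G by (simp add: field_simps power2_eq_square)
  moreover have "2 * D\<^sup>2 = sqrt 2 * (sqrt 2 * D\<^sup>2)"
    unfolding mult.assoc[symmetric] by simp
  ultimately have "sqrt 2 * (sqrt 2 * D\<^sup>2) = sqrt 2 * (sqrt pi / G\<^sup>2)"
    by simp
  hence "C\<^sup>2 = sqrt pi / G\<^sup>2"
    unfolding CD' by (subst (asm) mult_left_cancel) auto
  also have "\<dots> = (pi powr (1 / 4) / G)\<^sup>2"
    by (simp add: power_divide powr_power powr_half_sqrt)
  finally show ?thesis
    using C G by (subst (asm) power2_eq_iff_nonneg) (auto simp: C_def G_def)
qed

section \<open>Reduction of Ramanujan's function to theta values\<close>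

lemma theta3_nontriple_of_real:
  assumes "\<bar>x\<bar> < 1"
  shows "theta3_nontriple (of_real x :: complex) = of_real (theta3_nontriple x)"
  unfolding theta3_nontriple_def of_real_power[symmetric] using assms theta3_summable[of x]
  by (intro infsumI has_sum_of_real) simp

text \<open>The residue classes 1 and 2 modulo 3 are exchanged by n -> -n, whence the factor 2. In
  the second class n = 3k - 1, and n^2 = 3 k(k+1)/2 + 15 k(k-1)/2 + 1.\<close>

lemma ramanujan_theta_conv_nontriple:
  fixes x :: real
  assumes x: "0 < x" "x < 1"
  shows "theta3_nontriple x = 2 * x * ramanujan_theta (x ^ 3) (x ^ 15)"
proof -
  define A where "A = {n::int. n mod 3 = 1}"
  define B where "B = {n::int. n mod 3 = 2}"
  have sm: "(\<lambda>n::int. x ^ nat (n\<^sup>2)) summable_on S" for S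
    using x by (intro theta3_summable) simp
  have "{n::int. \<not> 3 dvd n} = A \<union> B" "A \<inter> B = {}"
    unfolding A_def B_def by (auto, presburger+)
  hence "theta3_nontriple x = (\<Sum>\<^sub>\<infinity>n\<in>A. x ^ nat (n\<^sup>2)) + (\<Sum>\<^sub>\<infinity>n\<in>B. x ^ nat (n\<^sup>2))"
    unfolding theta3_nontriple_def by (simp add: infsum_Un_disjoint[OF sm sm])
  also have "(\<Sum>\<^sub>\<infinity>n\<in>A. x ^ nat (n\<^sup>2)) = (\<Sum>\<^sub>\<infinity>n\<in>B. x ^ nat (n\<^sup>2))"
    by (rule infsum_reindex_bij_witness[of _ uminus uminus])
       (auto simp: A_def B_def zmod_zminus1_eq_if)
  also have "(\<Sum>\<^sub>\<infinity>n\<in>B. x ^ nat (n\<^sup>2)) =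
      (\<Sum>\<^sub>\<infinity>k\<in>UNIV. x * ((x ^ 3) powi (k * (k + 1) div 2) * (x ^ 15) powi (k * (k - 1) div 2)))"
  proof (rule infsum_reindex_bij_witness[of _ "\<lambda>k. 3 * k - 1" "\<lambda>n. (n + 1) div 3"])
    fix n assume "n \<in> B"
    define k where "k = (n + 1) div 3"
    have n: "n = 3 * k - 1"
      using \<open>n \<in> B\<close> unfolding B_def k_def by simp presburger
    have "even (k * (k + 1))" "even (k * (k - 1))" by simp_all
    then obtain a b where ab: "k * (k + 1) = 2 * a" "k * (k - 1) = 2 * b"
      by (meson dvdE)
    have "3 * (2 * a) + 15 * (2 * b) + 2 = 2 * n\<^sup>2"
      unfolding ab[symmetric] n by algebra
    hence "n\<^sup>2 = 3 * a + 15 * b + 1" by simp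
    moreover have "x ^ nat (n\<^sup>2) = x powi (n\<^sup>2)"
      by (simp add: power_int_nonneg_exp)
    ultimately have "x ^ nat (n\<^sup>2) = x * ((x ^ 3) powi a * (x ^ 15) powi b)"
      using x by (simp add: power_int_add power_int_power mult.commute)
    thus "x * ((x ^ 3) powi (((n + 1) div 3) * (((n + 1) div 3) + 1) div 2) *
        (x ^ 15) powi (((n + 1) div 3) * (((n + 1) div 3) - 1) div 2)) = x ^ nat (n\<^sup>2)"
      by (simp add: ab flip: k_def)
  next
    fix n assume "n \<in> B"
    thus "3 * ((n + 1) div 3) - 1 = n"
      unfolding B_def by simp presburger
  next
    fix k :: int
    show "3 * k - 1 \<in> B" unfolding B_def by simp presburger
  qed auto
  also have "\<dots> = x * ramanujan_theta (x ^ 3) (x ^ 15)"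
    unfolding ramanujan_theta_def infsum_cmult_right' ..
  finally show ?thesis by simp
qed


text \<open>For x = exp (-pi/3) inversion at t = 3 reads A + B = sqrt 3 A, so B = (sqrt 3 - 1) A.
  Inserting this in the cubic relation gives the factor 1 + (sqrt 3 - 1)^3 = 6 sqrt 3 - 9.\<close>

lemma theta3_exp_minus_3_pi:
  "theta3 (exp (- (3 * pi))) ^ 4 * (6 * sqrt 3 - 9) = theta3 (exp (- pi)) ^ 4"
  "2 * exp (- (pi / 3)) * ramanujan_theta (exp (- pi)) (exp (- (5 * pi))) =
     (sqrt 3 - 1) * theta3 (exp (- (3 * pi)))"
proof -
  define x where "x = exp (- (pi / 3))"
  define A B where "A = theta3 (exp (- (3 * pi)))" and "B = theta3_nontriple x"
  have x: "0 < x" "x < 1" "norm (complex_of_real x) < 1" "\<bar>x\<bar> < 1"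
    by (simp_all add: x_def)
  have pow: "x ^ 3 = exp (- pi)" "x ^ 9 = exp (- (3 * pi))" "x ^ 15 = exp (- (5 * pi))"
    by (simp_all add: x_def flip: exp_of_nat_mult)
  have lt: "\<bar>x ^ 3\<bar> < 1" "\<bar>x ^ 9\<bar> < 1"
    by (simp_all add: pow)
  have "complex_of_real (A * (A ^ 3 + B ^ 3)) = complex_of_real (theta3 (x ^ 3) ^ 4)"
    using theta3_cubic_relation[OF x(3)] theta3_of_real[OF lt(1)] theta3_of_real[OF lt(2)]
      theta3_nontriple_of_real[OF x(4)]
    by (simp add: A_def B_def flip: pow)
  hence 1: "A * (A ^ 3 + B ^ 3) = theta3 (exp (- pi)) ^ 4"
    unfolding of_real_eq_iff pow .
  have "complex_of_real (theta3 x) = complex_of_real (A + B)"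
    using theta3_split[of 1, OF _ x(3)] theta3_of_real[OF x(4)] theta3_of_real[OF lt(2)]
      theta3_nontriple_of_real[OF x(4)]
    by (simp add: A_def B_def flip: pow)
  moreover have "theta3 x = sqrt 3 * A"
    using theta3_inversion[of 3] by (simp add: x_def A_def mult.commute)
  ultimately have B: "B = (sqrt 3 - 1) * A"
    unfolding of_real_eq_iff by (simp add: algebra_simps)
  define s where "s = sqrt (3::real)"
  have s: "s\<^sup>2 = 3" by (simp add: s_def)
  have "(s - 1) ^ 3 = s\<^sup>2 * s - 3 * s\<^sup>2 + 3 * s - 1"
    by (simp add: eval_nat_numeral algebra_simps)
  hence "(s - 1) ^ 3 = 6 * s - 10"
    unfolding s by simp
  moreover have "A * (A ^ 3 + ((s - 1) * A) ^ 3) = A ^ 4 * (1 + (s - 1) ^ 3)"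
    by (simp add: power_mult_distrib power3_eq_cube power4_eq_xxxx distrib_left mult_ac)
  ultimately have "A * (A ^ 3 + ((s - 1) * A) ^ 3) = A ^ 4 * (6 * s - 9)"
    by simp
  with 1 B show "theta3 (exp (- (3 * pi))) ^ 4 * (6 * sqrt 3 - 9) = theta3 (exp (- pi)) ^ 4"
    by (simp add: A_def s_def)
  have "B = 2 * x * ramanujan_theta (exp (- pi)) (exp (- (5 * pi)))"
    using ramanujan_theta_conv_nontriple[OF x(1,2)] by (simp add: B_def pow)
  with B show "2 * exp (- (pi / 3)) * ramanujan_theta (exp (- pi)) (exp (- (5 * pi))) =
     (sqrt 3 - 1) * theta3 (exp (- (3 * pi)))"
    by (simp add: A_def x_def)
qed

text \<open>With \<open>t = 3\<^sup>1\<^sup>/\<^sup>4\<close>, \<open>s = 2\<^sup>1\<^sup>/\<^sup>2\<close>, \<open>u = 1 + t\<^sup>2 + s t\<^sup>3\<close>, \<open>v = 1 + t\<^sup>2 + s t\<close> and \<open>y = 1 + t\<^sup>2\<close>, the second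
  factor of the denominator is \<open>y u / 2\<close>, and \<open>v\<^sup>3 = y u\<^sup>2\<close>.\<close>

lemma radical_simplification:
  "2 powr (- 5 / 4) * 3 powr (- 3 / 8) * (sqrt 3 + 1) powr (5 / 6) *
    ((1 + sqrt 3 + sqrt 2 * 3 powr (3 / 4)) powr (5 / 3) /
      ((1 + sqrt 3 + sqrt 2 * root 4 3) *
       (2 + sqrt 3 + 1 / 2 * (sqrt 2 + sqrt 6) * 3 powr (3 / 4)))) =
    2 powr (- 1 / 4) * 3 powr (- 3 / 8) * (1 + sqrt 3) powr (- 1 / 2)"
proof -
  define t :: real where "t = 3 powr (1 / 4)"
  define s :: real where "s = sqrt 2"
  define u v y where "u = 1 + t\<^sup>2 + s * t ^ 3" and "v = 1 + t\<^sup>2 + s * t" and "y = 1 + t\<^sup>2"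
  have pos: "t > 0" "s > 0" by (simp_all add: t_def s_def)
  have t4: "t ^ 4 = 3" and s2: "s\<^sup>2 = 2"
    by (simp_all add: t_def s_def powr_power)
  have t2: "sqrt 3 = t\<^sup>2" and t3: "3 powr (3 / 4) = t ^ 3"
    by (simp_all add: t_def powr_power powr_half_sqrt)
  have t1: "root 4 3 = t"
    by (simp add: t_def root_powr_inverse)
  have s6: "sqrt 6 = s * t\<^sup>2"
    using real_sqrt_mult[of 2 3] by (simp add: s_def t2)
  have upos: "u > 0" "v > 0" "y > 0"
    unfolding u_def v_def y_def using pos by (auto intro!: add_pos_pos)
  have w: "2 + t\<^sup>2 + 1 / 2 * (s + s * t\<^sup>2) * t ^ 3 = y * u / 2"
  proof -
    have "y * u = 1 + 2 * t\<^sup>2 + t ^ 4 + (s + s * t\<^sup>2) * t ^ 3"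
      unfolding u_def y_def by (simp add: eval_nat_numeral algebra_simps)
    thus ?thesis unfolding t4 by simp
  qed
  have vu: "v ^ 3 = y * u\<^sup>2"
  proof -
    have "v = y + s * t" "u = y + s * t ^ 3"
      by (simp_all add: u_def v_def y_def)
    hence 1: "v ^ 3 = y ^ 3 + 3 * y\<^sup>2 * (s * t) + 3 * y * (s\<^sup>2 * t\<^sup>2) + s\<^sup>2 * (s * t ^ 3)"
      "y * u\<^sup>2 = y ^ 3 + 2 * y\<^sup>2 * (s * t ^ 3) + y * (s\<^sup>2 * (t ^ 4 * t\<^sup>2))"
      by (simp_all add: eval_nat_numeral algebra_simps)
    have y2: "y\<^sup>2 = 4 + 2 * t\<^sup>2"
      using t4 by (simp add: y_def eval_nat_numeral algebra_simps)
    have t5: "t\<^sup>2 * (s * t ^ 3) = 3 * (s * t)"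
      using t4 by (simp add: eval_nat_numeral)
    have t31: "t\<^sup>2 * (s * t) = s * t ^ 3"
      by (simp add: eval_nat_numeral)
    \<comment> \<open>Modulo s^2 = 2 and t^4 = 3 the remaining terms of the two expansions agree;
      only the part odd in \<open>s\<close> is left, and it is compared through y^2 = 4 + 2
      t^2.\<close>
    have "3 * y\<^sup>2 * (s * t) + 2 * (s * t ^ 3) = 12 * (s * t) + 6 * (t\<^sup>2 * (s * t)) + 2 * (s * t ^ 3)"
      unfolding y2 by (simp add: algebra_simps)
    also have "\<dots> = 8 * (s * t ^ 3) + 4 * (t\<^sup>2 * (s * t ^ 3))"
      unfolding t5 t31 by simp
    also have "\<dots> = 2 * y\<^sup>2 * (s * t ^ 3)"
      unfolding y2 by (simp add: algebra_simps)
    finally show ?thesis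
      unfolding 1 s2 t4 by simp
  qed
  hence "(v powr 3) powr (1 / 3) = (y * u powr 2) powr (1 / 3)"
    using upos by (simp add: powr_numeral)
  hence v: "v = y powr (1 / 3) * u powr (2 / 3)"
    using upos by (simp add: powr_powr powr_mult del: powr_numeral)
  \<comment> \<open>The exponent of y is 5/6 - 1/3 - 1 = -1/2, and that of u is 5/3 - 2/3 - 1 =
    0.\<close>
  have "y powr (5 / 6) * (u powr (5 / 3) / (v * (y * u / 2))) =
      2 * (y powr (5 / 6) * u powr (5 / 3) * (y powr (- 1 / 3) * u powr (- 2 / 3) * (y powr (- 1) * u powr (- 1))))"
    unfolding v using upos by (simp add: powr_minus field_simps)
  also have "\<dots> = 2 * ((y powr (5 / 6) * y powr (- 1 / 3) * y powr (- 1)) *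
      (u powr (5 / 3) * u powr (- 2 / 3) * u powr (- 1)))"
    by (simp only: mult_ac)
  also have "\<dots> = 2 * y powr (- 1 / 2)"
    unfolding powr_add[symmetric] using upos by simp
  finally have e: "y powr (5 / 6) * (u powr (5 / 3) / (v * (y * u / 2))) = 2 * y powr (- 1 / 2)" .
  have two: "2 powr (- 5 / 4) * 2 = (2::real) powr (- 1 / 4)"
    using powr_add[of "2::real" "- 5 / 4" 1] by simp
  have "2 powr (- 5 / 4) * 3 powr (- 3 / 8) * y powr (5 / 6) * (u powr (5 / 3) / (v * (y * u / 2))) =
      2 powr (- 5 / 4) * 3 powr (- 3 / 8) * (y powr (5 / 6) * (u powr (5 / 3) / (v * (y * u / 2))))"
    by (simp only: mult.assoc)
  also have "\<dots> = (2 powr (- 5 / 4) * 2) * 3 powr (- 3 / 8) * y powr (- 1 / 2)"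
    unfolding e by (simp only: mult_ac)
  finally have "2 powr (- 5 / 4) * 3 powr (- 3 / 8) * y powr (5 / 6) * (u powr (5 / 3) / (v * (y * u / 2))) =
      2 powr (- 1 / 4) * 3 powr (- 3 / 8) * y powr (- 1 / 2)"
    unfolding two .
  thus ?thesis
    unfolding t1 t3 t2 s6 s_def[symmetric] w add.commute[of "t\<^sup>2" 1]
    unfolding u_def v_def y_def .
qed

theorem theorem4p9:
  shows "ramanujan_theta (exp (- pi)) (exp (- 5 * pi)) =
    2 powr (- 5 / 4) * 3 powr (- 3 / 8) * exp (pi / 3) * (sqrt 3 + 1) powr (5 / 6) *
    ((1 + sqrt 3 + sqrt 2 * 3 powr (3 / 4)) powr (5 / 3) /
      ((1 + sqrt 3 + sqrt 2 * root 4 3) *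
       (2 + sqrt 3 + 1 / 2 * (sqrt 2 + sqrt 6) * 3 powr (3 / 4)))) *
    (pi powr (1 / 4) / Gamma (3 / 4 :: real))"
proof -
  define A C where "A = theta3 (exp (- (3 * pi)))" and "C = theta3 (exp (- pi))"
  \<comment> \<open>The simplified radical constant; the claim becomes f = K exp (pi/3) C. It is
    proved through fourth powers, because that is how \<open>A\<close> and \<open>C\<close> are
    related.\<close>
  define K :: real where "K = 2 powr (- 1 / 4) * 3 powr (- 3 / 8) * (1 + sqrt 3) powr (- 1 / 2)"
  define s where "s = sqrt (3::real)"
  have s: "s\<^sup>2 = 3" "s > 1" by (simp_all add: s_def)
  have pos: "A > 0" "C > 0" "K > 0"
  proof -
    have "0 < 1 + sqrt (3::real)" by (intro add_pos_nonneg) auto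
    thus "K > 0" by (simp add: K_def)
  qed (auto simp: A_def C_def intro!: theta3_pos)
  have "K ^ 4 = 2 powr (- 1) * 3 powr (- 3 / 2) * (1 + s) powr (- 2)"
  proof -
    have "1 + sqrt (3::real) \<noteq> 0" using s(2) unfolding s_def by linarith
    thus ?thesis by (simp add: K_def s_def power_mult_distrib powr_power)
  qed
  also have "3 powr (- 3 / 2) = 1 / (3 * s)"
  proof -
    have "3 powr (- 3 / 2) = 3 powr (- 1) * (3::real) powr (- (1 / 2))"
      using powr_add[of "3::real" "- 1" "- (1 / 2)"] by simp
    thus ?thesis by (simp add: s_def powr_minus powr_half_sqrt field_simps)
  qed
  also have "2 powr (- 1) * (1 / (3 * s)) * (1 + s) powr (- 2) = 1 / (6 * s * (1 + s)\<^sup>2)"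
    using s by (simp add: powr_minus powr_numeral field_simps)
  finally have K4: "K ^ 4 * (6 * s * (1 + s)\<^sup>2) = 1"
    using s by simp
  have "C ^ 4 = A ^ 4 * (6 * s - 9)"
    using theta3_exp_minus_3_pi(1) by (simp add: A_def C_def s_def)
  hence "(2 * K * C) ^ 4 = (16 * (6 * s - 9)) * K ^ 4 * A ^ 4"
    by (simp add: power_mult_distrib)
  \<comment> \<open>From (s - 1) (s + 1) = 2 the right side is 24 s (s - 1)^2 * 4 = 96 s - 48 s^2,
    using s^2 = 3.\<close>
  also have "16 * (6 * s - 9) = (s - 1) ^ 4 * (6 * s * (1 + s)\<^sup>2)"
  proof -
    have "(s - 1) ^ 4 * (6 * s * (1 + s)\<^sup>2) = 6 * s * ((s\<^sup>2 - 1)\<^sup>2 * (s\<^sup>2 - 2 * s + 1))"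
      by (simp add: eval_nat_numeral algebra_simps)
    also have "\<dots> = 96 * s - 48 * s\<^sup>2"
      unfolding s(1) by (simp add: algebra_simps s(1) flip: power2_eq_square)
    finally show ?thesis
      unfolding s(1) by simp
  qed
  also have "(s - 1) ^ 4 * (6 * s * (1 + s)\<^sup>2) * K ^ 4 * A ^ 4 =
      (K ^ 4 * (6 * s * (1 + s)\<^sup>2)) * ((s - 1) * A) ^ 4"
    by (simp only: power_mult_distrib mult_ac)
  finally have "(2 * K * C) ^ 4 = ((s - 1) * A) ^ 4"
    unfolding K4 by simp
  \<comment> \<open>Both bases are positive, so equal fourth powers force equality.\<close>
  hence "2 * K * C = (s - 1) * A"
    using pos s by (subst (asm) power_eq_iff_eq_base) auto
  hence "2 * exp (- (pi / 3)) * ramanujan_theta (exp (- pi)) (exp (- (5 * pi))) = 2 * K * C"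
    using theta3_exp_minus_3_pi(2) by (simp add: A_def s_def)
  hence "ramanujan_theta (exp (- pi)) (exp (- 5 * pi)) = K * exp (pi / 3) * C"
    by (simp add: exp_minus field_simps)
  thus ?thesis
    unfolding K_def C_def theta3_exp_minus_pi radical_simplification[symmetric]
    by (simp only: mult_ac)
qed

end
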